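(* For every positive integer $d$, let $\hat{\alpha}_{\le}(d,3)$ be the number of isomorphism classes of symmetric $4\times 4$ matrices with zeros on the main diagonal and off-diagonal entries in $\{1,\dots,d\}$ that fulfill the triangle inequalities, and let $\hat{\alpha}(d,3)$ be the number of those isomorphism classes whose matrices have diameter (largest entry) exactly $d$. Then $$\hat{\alpha}_{\le}(d,3)=\begin{cases}\dfrac{17d^6+425d^4+1628d^2}{2880} & \text{if } d\equiv 0 \pmod 2,\\[2mm] \dfrac{17d^6+425d^4+1763d^2+675}{2880} & \text{if } d\equiv 1 \pmod 2,\end{cases}$$ and $$\hat{\alpha}(d,3)=\begin{cases}\dfrac{34d^5-85d^4+680d^3-980d^2+1776d-960}{960} & \text{if } d\equiv 0 \pmod 2,\\[2mm] \dfrac{34d^5-85d^4+680d^3-890d^2+1686d-465}{960} & \text{if } d\equiv 1 \pmod 2.\end{cases}$$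
   Context: Rows and columns are indexed by $0,1,2,3$. Two symmetric $4\times4$ matrices $(\delta_{i,j})$ and $(\delta'_{i,j})$ are isomorphic if there is a permutation $\tau$ of $\{0,1,2,3\}$ with $\delta'_{i,j}=\delta_{\tau(i),\tau(j)}$ for all $i,j$. A matrix $(\delta_{i,j})$ fulfills the triangle inequalities if $\delta_{i,j}+\delta_{j,k}>\delta_{i,k}$ (strict inequality) for all pairwise distinct $i,j,k\in\{0,1,2,3\}$. *)

theory Defs
  imports "HOL-Analysis.Finite_Cartesian_Product" "HOL-Library.Numeral_Type"
    "HOL-Combinatorics.Permutations"
begin

(* The index type 4 has exactly the elements 0, 1, 2, 3; its arithmetic modulo 4 is never used. *)
type_synonym mat4 = "nat ^ 4 ^ 4"

definition isomorphic :: "mat4 \<Rightarrow> mat4 \<Rightarrow> bool" where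
  "isomorphic A B \<longleftrightarrow> (\<exists>\<tau>. \<tau> permutes UNIV \<and> (\<forall>i j. B $ i $ j = A $ \<tau> i $ \<tau> j))"

definition triangle_inequalities :: "mat4 \<Rightarrow> bool" where
  "triangle_inequalities A \<longleftrightarrow>
     (\<forall>i j k. i \<noteq> j \<and> j \<noteq> k \<and> i \<noteq> k \<longrightarrow> A $ i $ j + A $ j $ k > A $ i $ k)"

definition diameter4 :: "mat4 \<Rightarrow> nat" where
  "diameter4 A = Max {A $ i $ j | i j. True}"

definition metric_matrices :: "nat \<Rightarrow> mat4 set" where
  "metric_matrices d =
     {A. Finite_Cartesian_Product.transpose A = A \<and> (\<forall>i. A $ i $ i = 0) \<and>
         (\<forall>i j. i \<noteq> j \<longrightarrow> A $ i $ j \<in> {1..d}) \<and> triangle_inequalities A}"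

definition iso_rel :: "nat \<Rightarrow> (mat4 \<times> mat4) set" where
  "iso_rel d = {(A, B). A \<in> metric_matrices d \<and> B \<in> metric_matrices d \<and> isomorphic A B}"

definition iso_classes :: "nat \<Rightarrow> mat4 set set" where
  "iso_classes d = metric_matrices d // iso_rel d"

definition alpha_hat_le :: "nat \<Rightarrow> nat" where
  "alpha_hat_le d = card (iso_classes d)"

definition alpha_hat :: "nat \<Rightarrow> nat" where
  "alpha_hat d = card {C \<in> iso_classes d. \<forall>A\<in>C. diameter4 A = d}"

lemma equiv_iso_rel: "equiv (metric_matrices d) (iso_rel d)"
proof (rule equivI)
  show "iso_rel d \<subseteq> metric_matrices d \<times> metric_matrices d"
    by (auto simp: iso_rel_def)
  show "refl_on (metric_matrices d) (iso_rel d)"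
    by (auto simp: refl_on_def iso_rel_def isomorphic_def intro!: exI[of _ id] permutes_id)
  have "isomorphic B A" if "isomorphic A B" for A B
  proof -
    from that obtain \<tau> where "\<tau> permutes UNIV" "\<And>i j. B $ i $ j = A $ \<tau> i $ \<tau> j"
      by (auto simp: isomorphic_def)
    then show ?thesis
      unfolding isomorphic_def
      by (intro exI[of _ "inv \<tau>"]) (simp add: permutes_inv permutes_inverses)
  qed
  then show "sym (iso_rel d)"
    by (auto simp: sym_def iso_rel_def)
  have "isomorphic A C" if "isomorphic A B" "isomorphic B C" for A B C
  proof -
    from that obtain \<sigma> \<tau> where "\<sigma> permutes UNIV" "\<And>i j. B $ i $ j = A $ \<sigma> i $ \<sigma> j"
      "\<tau> permutes UNIV" "\<And>i j. C $ i $ j = B $ \<tau> i $ \<tau> j"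
      by (auto simp: isomorphic_def)
    then show ?thesis
      unfolding isomorphic_def
      by (intro exI[of _ "\<sigma> \<circ> \<tau>"]) (simp add: permutes_compose)
  qed
  then show "trans (iso_rel d)"
    by (auto simp: trans_def iso_rel_def)
qed

lemma diameter4_isomorphic:
  assumes "isomorphic A B"
  shows "diameter4 A = diameter4 B"
proof -
  from assms obtain \<tau> where \<tau>: "\<tau> permutes UNIV" "\<And>i j. B $ i $ j = A $ \<tau> i $ \<tau> j"
    by (auto simp: isomorphic_def)
  have "{A $ i $ j | i j. True} = {B $ i $ j | i j. True}"
    unfolding \<tau>(2) by (auto; metis permutes_inverses(1)[OF \<tau>(1)])
  then show ?thesis
    by (simp add: diameter4_def)
qed

end

theory Submission
  imports Defs "HOL-Analysis.Cartesian_Space" "HOL-Algebra.Group_Action"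
begin

text \<open>Both formulas follow from the first one: the isomorphism classes of diameter at most $d - 1$
are exactly the classes of diameter at most $d$ whose diameter is not $d$, so \<open>alpha_hat\<close> is the
difference of consecutive values of \<open>alpha_hat_le\<close>.

\<^bold>\<open>Orbit counting.\<close> Isomorphism classes are the orbits of the symmetric group on the four vertices.
By Burnside's lemma, 24 times their number is the sum over all permutations of the number of
matrices that they fix, and this number depends only on the cycle type. A matrix is recorded by
its six edges, listed as three pairs of opposite edges: \<open>x = {0,1}\<close>, \<open>y = {2,3}\<close>; \<open>u = {0,2}\<close>,
\<open>t = {1,3}\<close>; \<open>v = {1,2}\<close>, \<open>s = {0,3}\<close>. The four triangles are then \<open>xuv\<close>, \<open>xst\<close>, \<open>yus\<close>, \<open>yvt\<close>. A
permutation other than the identity leaves at most four of the edges free, and given two sides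
$a, b$ of a triangle the number of admissible third sides is \<open>min (2 m - 1) n\<close>, where $m$ is the
smaller of the two sides and $n = d - |a - b|$. These counts are therefore sums over $a, b$ of a
function of $m$ and $n$, called gap sums below, or, for three-cycles and four-cycles, single sums
of the same shape.

\<^bold>\<open>The identity.\<close> The number of all metric edge tuples has degree 6 in $d$ and is obtained by
summing over the diameter. The tuples of diameter exactly $d$ are counted by inclusion and
exclusion over the set of edges of length $d$. Up to symmetry ten sets occur, and an edge of
length $d$ simplifies everything: a triangle with sides $d, a, b$ only asks for $a + b > d$.
Whenever two or more edges have length $d$, what is left is a gap sum or an elementary sum.

\<^bold>\<open>One edge of length d.\<close> If $x = d$, the conditions left over are $u + v > d$, $s + t > d$,
$|u - s| < y < u + s$ and $|v - t| < y < v + t$. The two upper bounds on $y$ cannot fail together,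
since $u + v + s + t > 2d \ge 2y$, and if one fails then the other conditions on $y$ are
automatic, so that the failures are easy to count (\<open>card_flat_tuples\<close>). Without the upper bounds,
fix $u, s, y$ with $|u - s| < y$. The pairs $(v, t)$ form a $u \times s$ rectangle from which the
condition $|v - t| < y$ cuts off two triangular corners, so their number is
$us - T(u - y) - T(s - y)$ with triangular numbers $T$ (\<open>card_near_pairs\<close>).

\<^bold>\<open>Parity.\<close> The function \<open>min (2 m - 1) n\<close> and the condition \<open>2 m > n\<close> change at half of $n$, and
this is the only source of the dependence on the parity of $d$. Intermediate closed forms express
it by $(-1)^d$, which lets both parities go through one induction.\<close>

section \<open>Orbits of metric matrices\<close>

lemma all_4: "(\<forall>i::4. P i) \<longleftrightarrow> P 0 \<and> P 1 \<and> P 2 \<and> P 3"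
proof -
  have "(4::4) = 0" by simp
  then show ?thesis using forall_4[of P] by metis
qed

lemma UNIV_4': "(UNIV :: 4 set) = {0, 1, 2, 3}"
  using all_4[of "\<lambda>i. i \<in> {0, 1, 2, 3}"] by auto

definition permute_matrix :: "(4 \<Rightarrow> 4) \<Rightarrow> mat4 \<Rightarrow> mat4" where
  "permute_matrix \<tau> A = (\<chi> i j. A $ \<tau> i $ \<tau> j)"

definition fixed_matrices :: "nat \<Rightarrow> (4 \<Rightarrow> 4) \<Rightarrow> mat4 set" where
  "fixed_matrices d \<tau> = {A \<in> metric_matrices d. permute_matrix \<tau> A = A}"

abbreviation num_fixed :: "nat \<Rightarrow> (4 \<Rightarrow> 4) \<Rightarrow> nat" where
  "num_fixed d \<tau> \<equiv> card (fixed_matrices d \<tau>)"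

lemma permute_matrix_nth [simp]: "permute_matrix \<tau> A $ i $ j = A $ \<tau> i $ \<tau> j"
  by (simp add: permute_matrix_def)

lemma permute_matrix_comp: "permute_matrix \<tau> (permute_matrix \<sigma> A) = permute_matrix (\<sigma> \<circ> \<tau>) A"
  by (simp add: vec_eq_iff)

lemma permute_matrix_id: "permute_matrix id A = A"
  by (simp add: vec_eq_iff)

lemma metric_matrices_iff:
  "A \<in> metric_matrices d \<longleftrightarrow> (\<forall>i j. A $ i $ j = A $ j $ i) \<and> (\<forall>i. A $ i $ i = 0) \<and>
     (\<forall>i j. i \<noteq> j \<longrightarrow> 1 \<le> A $ i $ j \<and> A $ i $ j \<le> d) \<and>
     (\<forall>i j k. i \<noteq> j \<and> j \<noteq> k \<and> i \<noteq> k \<longrightarrow> A $ i $ j + A $ j $ k > A $ i $ k)"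
  unfolding metric_matrices_def triangle_inequalities_def
  by (auto simp: vec_eq_iff Finite_Cartesian_Product.transpose_def)

lemma permute_matrix_metric:
  assumes "bij \<tau>" "A \<in> metric_matrices d"
  shows "permute_matrix \<tau> A \<in> metric_matrices d"
proof -
  have "\<tau> i = \<tau> j \<longleftrightarrow> i = j" for i j
    using assms(1) by (meson bij_is_inj inj_eq)
  then show ?thesis
    using assms(2) by (simp add: metric_matrices_iff)
qed

lemma finite_metric_matrices: "finite (metric_matrices d)"
proof -
  let ?F = "Pi\<^sub>E (UNIV :: (4 \<times> 4) set) (\<lambda>_. {0..d})"
  let ?h = "\<lambda>f. (\<chi> i j. f (i, j)) :: mat4"
  have "metric_matrices d \<subseteq> ?h ` ?F"
  proof
    fix A assume A: "A \<in> metric_matrices d"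
    have "A $ i $ j \<le> d" for i j
      using A unfolding metric_matrices_iff by (cases "i = j") auto
    then show "A \<in> ?h ` ?F"
      by (intro image_eqI[where x = "\<lambda>(i, j). A $ i $ j"])
          (simp_all add: vec_eq_iff PiE_iff extensional_def)
  qed
  moreover have "finite ?F"
    by (intro finite_PiE) auto
  ultimately show ?thesis
    by (meson finite_imageI finite_subset)
qed

text \<open>Relabelling by \<open>\<sigma>\<close> carries the matrices fixed by \<open>\<rho>\<close> to those fixed by the conjugate
permutation \<open>\<tau>\<close>, so one representative of each conjugacy class suffices.\<close>

lemma card_fixed_conjugate:
  assumes "bij \<sigma>" "\<sigma> \<circ> \<tau> = \<rho> \<circ> \<sigma>"
  shows "num_fixed d \<tau> = num_fixed d \<rho>"
proof -
  have inverse: "\<sigma> \<circ> inv_into UNIV \<sigma> = id" "inv_into UNIV \<sigma> \<circ> \<sigma> = id"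
    using assms(1) by (auto simp: surj_iff[symmetric] bij_is_surj bij_is_inj)
  have bij_inv: "bij (inv_into UNIV \<sigma>)"
    using assms(1) by (rule bij_imp_bij_inv)
  have commute': "\<tau> \<circ> inv_into UNIV \<sigma> = inv_into UNIV \<sigma> \<circ> \<rho>"
  proof -
    have "inv_into UNIV \<sigma> \<circ> (\<sigma> \<circ> \<tau>) \<circ> inv_into UNIV \<sigma> = inv_into UNIV \<sigma> \<circ> (\<rho> \<circ> \<sigma>) \<circ> inv_into UNIV \<sigma>"
      by (simp only: assms(2))
    then show ?thesis
      by (simp only: comp_assoc inverse comp_id) (simp only: comp_assoc[symmetric] inverse id_comp)
  qed
  have "bij_betw (permute_matrix \<sigma>) (fixed_matrices d \<rho>) (fixed_matrices d \<tau>)"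
  proof (rule bij_betw_byWitness[where f' = "permute_matrix (inv_into UNIV \<sigma>)"])
    show "\<forall>A\<in>fixed_matrices d \<rho>. permute_matrix (inv_into UNIV \<sigma>) (permute_matrix \<sigma> A) = A"
      by (simp add: permute_matrix_comp inverse permute_matrix_id)
    show "\<forall>A\<in>fixed_matrices d \<tau>. permute_matrix \<sigma> (permute_matrix (inv_into UNIV \<sigma>) A) = A"
      by (simp add: permute_matrix_comp inverse permute_matrix_id)
    show "permute_matrix \<sigma> ` fixed_matrices d \<rho> \<subseteq> fixed_matrices d \<tau>"
      using assms by (auto simp: fixed_matrices_def permute_matrix_metric permute_matrix_comp)
        (metis permute_matrix_comp)
    show "permute_matrix (inv_into UNIV \<sigma>) ` fixed_matrices d \<tau> \<subseteq> fixed_matrices d \<rho>"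
      using bij_inv commute' by (auto simp: fixed_matrices_def permute_matrix_metric permute_matrix_comp)
        (metis permute_matrix_comp)
  qed
  then show ?thesis
    by (metis bij_betw_same_card)
qed

abbreviation double_transposition :: "4 \<Rightarrow> 4" where
  "double_transposition \<equiv> transpose 0 1 \<circ> transpose 2 3"

abbreviation three_cycle :: "4 \<Rightarrow> 4" where
  "three_cycle \<equiv> transpose 0 1 \<circ> transpose 1 2"

abbreviation four_cycle :: "4 \<Rightarrow> 4" where
  "four_cycle \<equiv> transpose 0 1 \<circ> (transpose 1 2 \<circ> transpose 2 3)"

text \<open>The permutations are written as products of transpositions in the form in which
\<open>sum_over_permutations_insert\<close> enumerates them. The permutation given to the rule is a conjugating
permutation.\<close>

lemma card_fixed_transpositions:
  "num_fixed d (transpose 2 3) = num_fixed d (transpose 0 1)"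
  "num_fixed d (transpose 1 2) = num_fixed d (transpose 0 1)"
  "num_fixed d (transpose 1 3) = num_fixed d (transpose 0 1)"
  "num_fixed d (transpose 0 2) = num_fixed d (transpose 0 1)"
  "num_fixed d (transpose 0 3) = num_fixed d (transpose 0 1)"
  by ((rule card_fixed_conjugate[of "transpose 0 2 \<circ> transpose 1 3"]; simp add: bij_comp fun_eq_iff all_4)[1],
      (rule card_fixed_conjugate[of "transpose 0 2"]; simp add: bij_comp fun_eq_iff all_4)[1],
      (rule card_fixed_conjugate[of "transpose 0 3"]; simp add: bij_comp fun_eq_iff all_4)[1],
      (rule card_fixed_conjugate[of "transpose 1 2"]; simp add: bij_comp fun_eq_iff all_4)[1],
      (rule card_fixed_conjugate[of "transpose 1 3"]; simp add: bij_comp fun_eq_iff all_4)[1])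

lemma card_fixed_double_transpositions:
  "num_fixed d (transpose 0 2 \<circ> transpose 1 3) = num_fixed d double_transposition"
  "num_fixed d (transpose 0 3 \<circ> transpose 1 2) = num_fixed d double_transposition"
  by ((rule card_fixed_conjugate[of "transpose 0 3"]; simp add: bij_comp fun_eq_iff all_4)[1],
      (rule card_fixed_conjugate[of "transpose 0 2"]; simp add: bij_comp fun_eq_iff all_4)[1])

lemma card_fixed_three_cycles:
  "num_fixed d (transpose 1 2 \<circ> transpose 2 3) = num_fixed d three_cycle"
  "num_fixed d (transpose 1 3 \<circ> transpose 2 3) = num_fixed d three_cycle"
  "num_fixed d (transpose 0 1 \<circ> transpose 1 3) = num_fixed d three_cycle"
  "num_fixed d (transpose 0 2 \<circ> transpose 2 3) = num_fixed d three_cycle"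
  "num_fixed d (transpose 0 2 \<circ> transpose 1 2) = num_fixed d three_cycle"
  "num_fixed d (transpose 0 3 \<circ> transpose 2 3) = num_fixed d three_cycle"
  "num_fixed d (transpose 0 3 \<circ> transpose 1 3) = num_fixed d three_cycle"
  by ((rule card_fixed_conjugate[of "transpose 0 3"]; simp add: bij_comp fun_eq_iff all_4)[1],
      (rule card_fixed_conjugate[of "transpose 0 1 \<circ> transpose 0 3"]; simp add: bij_comp fun_eq_iff all_4)[1],
      (rule card_fixed_conjugate[of "transpose 2 3"]; simp add: bij_comp fun_eq_iff all_4)[1],
      (rule card_fixed_conjugate[of "transpose 0 1 \<circ> transpose 1 3"]; simp add: bij_comp fun_eq_iff all_4)[1],
      (rule card_fixed_conjugate[of "transpose 0 1"]; simp add: bij_comp fun_eq_iff all_4)[1],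
      (rule card_fixed_conjugate[of "transpose 1 3"]; simp add: bij_comp fun_eq_iff all_4)[1],
      (rule card_fixed_conjugate[of "transpose 0 1 \<circ> transpose 2 3"]; simp add: bij_comp fun_eq_iff all_4)[1])

lemma card_fixed_four_cycles:
  "num_fixed d (transpose 0 1 \<circ> (transpose 1 3 \<circ> transpose 2 3)) = num_fixed d four_cycle"
  "num_fixed d (transpose 0 2 \<circ> (transpose 1 2 \<circ> transpose 2 3)) = num_fixed d four_cycle"
  "num_fixed d (transpose 0 2 \<circ> (transpose 1 3 \<circ> transpose 2 3)) = num_fixed d four_cycle"
  "num_fixed d (transpose 0 3 \<circ> (transpose 1 2 \<circ> transpose 2 3)) = num_fixed d four_cycle"
  "num_fixed d (transpose 0 3 \<circ> (transpose 1 3 \<circ> transpose 2 3)) = num_fixed d four_cycle"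
  by ((rule card_fixed_conjugate[of "transpose 2 3"]; simp add: bij_comp fun_eq_iff all_4)[1],
      (rule card_fixed_conjugate[of "transpose 0 1"]; simp add: bij_comp fun_eq_iff all_4)[1],
      (rule card_fixed_conjugate[of "transpose 1 2"]; simp add: bij_comp fun_eq_iff all_4)[1],
      (rule card_fixed_conjugate[of "transpose 0 3"]; simp add: bij_comp fun_eq_iff all_4)[1],
      (rule card_fixed_conjugate[of "transpose 0 2"]; simp add: bij_comp fun_eq_iff all_4)[1])

text \<open>The assignment $\tau \mapsto (A_{\tau(i),\tau(j)})$ reverses products, hence the inverse
permutation here.\<close>

lemma metric_matrix_action:
  "group_action (BijGroup (UNIV :: 4 set)) (metric_matrices d)
     (\<lambda>\<tau>. restrict (permute_matrix (inv_into UNIV \<tau>)) (metric_matrices d))"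
proof -
  let ?M = "metric_matrices d"
  let ?\<phi> = "\<lambda>\<tau>. restrict (permute_matrix (inv_into UNIV \<tau>)) ?M"
  have bij: "?\<phi> \<tau> \<in> Bij ?M" if "bij \<tau>" for \<tau>
  proof -
    have b': "bij (inv_into UNIV \<tau>)"
      using that by (rule bij_imp_bij_inv)
    have "bij_betw (permute_matrix (inv_into UNIV \<tau>)) ?M ?M"
    proof (rule bij_betw_byWitness[where f' = "permute_matrix \<tau>"])
      show "\<forall>A\<in>?M. permute_matrix \<tau> (permute_matrix (inv_into UNIV \<tau>) A) = A"
        using that by (simp add: vec_eq_iff bij_is_inj)
      show "\<forall>A\<in>?M. permute_matrix (inv_into UNIV \<tau>) (permute_matrix \<tau> A) = A"
        using that by (simp add: vec_eq_iff bij_is_surj surj_f_inv_f)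
    qed (use that b' permute_matrix_metric in auto)
    then show ?thesis
      by (auto simp: Bij_def bij_betw_restrict_eq)
  qed
  have mult: "?\<phi> (compose UNIV \<sigma> \<tau>) = compose ?M (?\<phi> \<sigma>) (?\<phi> \<tau>)" if "bij \<sigma>" "bij \<tau>" for \<sigma> \<tau>
  proof
    fix A
    have "compose UNIV \<sigma> \<tau> = \<sigma> \<circ> \<tau>"
      by (auto simp: compose_def)
    moreover have "permute_matrix (inv_into UNIV \<tau>) A \<in> ?M" if "A \<in> ?M"
      using \<open>bij \<tau>\<close> that permute_matrix_metric bij_imp_bij_inv by blast
    ultimately show "?\<phi> (compose UNIV \<sigma> \<tau>) A = compose ?M (?\<phi> \<sigma>) (?\<phi> \<tau>) A"
      using that by (auto simp: compose_def o_inv_distrib permute_matrix_comp)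
  qed
  show ?thesis
    unfolding group_action_def group_hom_def group_hom_axioms_def
  proof (intro conjI group_BijGroup homI)
    fix \<sigma> \<tau> :: "4 \<Rightarrow> 4"
    assume "\<sigma> \<in> carrier (BijGroup UNIV)" "\<tau> \<in> carrier (BijGroup UNIV)"
    then have "bij \<sigma>" "bij \<tau>"
      by (auto simp: BijGroup_def Bij_def)
    then show "?\<phi> \<sigma> \<in> carrier (BijGroup ?M)"
      and "?\<phi> (\<sigma> \<otimes>\<^bsub>BijGroup UNIV\<^esub> \<tau>) = ?\<phi> \<sigma> \<otimes>\<^bsub>BijGroup ?M\<^esub> ?\<phi> \<tau>"
      using bij mult by (auto simp: BijGroup_def Bij_def)
  qed
qed

text \<open>The inverse in the action changes nothing: $\tau$ and its inverse fix the same matrices and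
generate the same orbits.\<close>

lemma burnside_metric_matrices:
  "alpha_hat_le d * 24 = (\<Sum>\<tau> | \<tau> permutes (UNIV :: 4 set). num_fixed d \<tau>)"
proof -
  let ?M = "metric_matrices d"
  let ?\<phi> = "\<lambda>\<tau>. restrict (permute_matrix (inv_into UNIV \<tau>)) ?M"
  interpret group_action "BijGroup (UNIV :: 4 set)" ?M ?\<phi>
    by (rule metric_matrix_action)
  have carrier: "carrier (BijGroup (UNIV :: 4 set)) = {\<tau>. \<tau> permutes UNIV}"
    by (auto simp: BijGroup_def Bij_def permutes_univ bij_iff)
  have iso: "isomorphic A B \<longleftrightarrow> (\<exists>\<tau>. \<tau> permutes UNIV \<and> B = permute_matrix (inv_into UNIV \<tau>) A)" for A B
  proof -
    have "isomorphic A B \<longleftrightarrow> (\<exists>\<tau>. \<tau> permutes UNIV \<and> B = permute_matrix \<tau> A)"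
      by (simp add: isomorphic_def vec_eq_iff)
    also have "\<dots> \<longleftrightarrow> (\<exists>\<tau>. \<tau> permutes UNIV \<and> B = permute_matrix (inv_into UNIV \<tau>) A)"
      by (metis permutes_inv permutes_inv_inv)
    finally show ?thesis .
  qed
  have "iso_rel d `` {A} = orbit (BijGroup UNIV) ?\<phi> A" if "A \<in> ?M" for A
    using that permute_matrix_metric[OF bij_imp_bij_inv, of _ A d]
    by (auto simp: iso_rel_def orbit_def carrier iso permutes_bij)
  then have orbits: "iso_classes d = orbits (BijGroup UNIV) ?M ?\<phi>"
    unfolding iso_classes_def orbits_def quotient_def by auto
  have "order (BijGroup (UNIV :: 4 set)) = 24"
    unfolding order_def carrier using card_permutations[of "UNIV :: 4 set" 4]
    by (simp add: fact_numeral)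
  then have "alpha_hat_le d * 24 = card (orbits (BijGroup UNIV) ?M ?\<phi>) * order (BijGroup (UNIV :: 4 set))"
    by (simp add: alpha_hat_le_def orbits)
  also have "\<dots> = (\<Sum>\<tau> | \<tau> permutes (UNIV :: 4 set). card (invariants ?M ?\<phi> \<tau>))"
    by (subst burnside) (simp_all add: carrier finite_metric_matrices finite_permutations)
  also have "\<dots> = (\<Sum>\<tau> | \<tau> permutes (UNIV :: 4 set). num_fixed d \<tau>)"
  proof (rule sum.cong[OF refl])
    fix \<tau> :: "4 \<Rightarrow> 4" assume "\<tau> \<in> {\<tau>. \<tau> permutes UNIV}"
    then have \<tau>: "bij \<tau>"
      by (simp add: permutes_bij)
    have "permute_matrix (inv_into UNIV \<tau>) A = A \<longleftrightarrow> permute_matrix \<tau> A = A" for A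
    proof -
      have "\<tau> \<circ> inv_into UNIV \<tau> = id" "inv_into UNIV \<tau> \<circ> \<tau> = id"
        using \<tau> by (auto simp: surj_iff[symmetric] bij_is_surj bij_is_inj)
      then show ?thesis
        by (metis permute_matrix_comp permute_matrix_id)
    qed
    then show "card (invariants ?M ?\<phi> \<tau>) = num_fixed d \<tau>"
      by (auto simp: invariants_def fixed_matrices_def intro!: arg_cong[where f = card])
  qed
  finally show ?thesis .
qed

lemma sum_permutations_4:
  fixes F :: "(4 \<Rightarrow> 4) \<Rightarrow> nat"
  shows "(\<Sum>\<tau> | \<tau> permutes UNIV. F \<tau>) =
    (\<Sum>b\<in>{0, 1, 2, 3}. \<Sum>c\<in>{1, 2, 3}. \<Sum>e\<in>{2, 3}.
       F (transpose 0 b \<circ> (transpose 1 c \<circ> (transpose 2 e \<circ> id))))"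
  unfolding UNIV_4' by (simp add: sum_over_permutations_insert del: sum.insert)

lemma orbit_count:
  "24 * alpha_hat_le d = card (metric_matrices d)
     + 6 * num_fixed d (transpose 0 1)
     + 3 * num_fixed d double_transposition
     + 8 * num_fixed d three_cycle
     + 6 * num_fixed d four_cycle"
proof -
  have fixed_id: "fixed_matrices d id = metric_matrices d"
    by (auto simp: fixed_matrices_def permute_matrix_id)
  have sums: "sum f {0, 1, 2, 3::4} = f 0 + f 1 + f 2 + f 3"
    "sum f {1, 2, 3::4} = f 1 + f 2 + f 3" "sum f {2, 3::4} = f 2 + f 3" for f :: "4 \<Rightarrow> nat"
    by simp_all
  have trivial: "transpose 0 0 = (id :: 4 \<Rightarrow> 4)" "transpose 1 1 = (id :: 4 \<Rightarrow> 4)"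
    "transpose 2 2 = (id :: 4 \<Rightarrow> 4)"
    by simp_all
  show ?thesis
    using burnside_metric_matrices[of d]
    unfolding sum_permutations_4 sums trivial comp_id id_comp
    by (simp only: card_fixed_transpositions card_fixed_double_transpositions fixed_id
        card_fixed_three_cycles card_fixed_four_cycles)
qed

text \<open>Metric matrices are replaced by the tuples of their six off-diagonal entries. Opposite edges
are adjacent in the tuple \<open>(x, y, u, t, v, s)\<close>.\<close>

definition tri :: "nat \<Rightarrow> nat \<Rightarrow> nat \<Rightarrow> bool" where
  "tri a b c \<longleftrightarrow> a < b + c \<and> b < a + c \<and> c < a + b"

definition metric_edges :: "nat \<Rightarrow> (nat \<times> nat \<times> nat \<times> nat \<times> nat \<times> nat) set" where
  "metric_edges d = {(x, y, u, t, v, s). x \<in> {1..d} \<and> y \<in> {1..d} \<and> u \<in> {1..d} \<and> t \<in> {1..d} \<and>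
     v \<in> {1..d} \<and> s \<in> {1..d} \<and> tri x u v \<and> tri x s t \<and> tri y u s \<and> tri y v t}"

definition edges :: "mat4 \<Rightarrow> nat \<times> nat \<times> nat \<times> nat \<times> nat \<times> nat" where
  "edges A = (A $ 0 $ 1, A $ 2 $ 3, A $ 0 $ 2, A $ 1 $ 3, A $ 1 $ 2, A $ 0 $ 3)"

lemma finite_metric_edges: "finite (metric_edges d)"
  by (rule finite_subset[of _ "{1..d} \<times> {1..d} \<times> {1..d} \<times> {1..d} \<times> {1..d} \<times> {1..d}"])
    (auto simp: metric_edges_def)

lemma edges_metric_matrix:
  assumes "A \<in> metric_matrices d"
  shows "edges A \<in> metric_edges d"
proof -
  have "A $ i $ j \<in> {1..d}" if "i \<noteq> j" for i j
    using assms that unfolding metric_matrices_iff by simp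
  moreover have "tri (A $ i $ j) (A $ i $ k) (A $ j $ k)" "tri (A $ j $ k) (A $ i $ j) (A $ i $ k)"
    if "i \<noteq> j" "j \<noteq> k" "i \<noteq> k" for i j k
  proof -
    have "A $ j $ i = A $ i $ j" "A $ k $ j = A $ j $ k" "A $ k $ i = A $ i $ k"
      using assms unfolding metric_matrices_iff by blast+
    moreover have "A $ i $ k < A $ i $ j + A $ j $ k" "A $ i $ j < A $ i $ k + A $ k $ j"
      "A $ j $ k < A $ j $ i + A $ i $ k"
      using assms that unfolding metric_matrices_iff by metis+
    ultimately show "tri (A $ i $ j) (A $ i $ k) (A $ j $ k)" "tri (A $ j $ k) (A $ i $ j) (A $ i $ k)"
      unfolding tri_def by linarith+
  qed
  ultimately show ?thesis
    by (simp add: edges_def metric_edges_def)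
qed

lemma metric_matrix_symmetric:
  assumes "A \<in> metric_matrices d"
  shows "A $ 1 $ 0 = A $ 0 $ 1" "A $ 2 $ 0 = A $ 0 $ 2" "A $ 3 $ 0 = A $ 0 $ 3"
    "A $ 2 $ 1 = A $ 1 $ 2" "A $ 3 $ 1 = A $ 1 $ 3" "A $ 3 $ 2 = A $ 2 $ 3" "A $ i $ i = 0"
  using assms unfolding metric_matrices_iff by blast+

definition edges_matrix :: "nat \<times> nat \<times> nat \<times> nat \<times> nat \<times> nat \<Rightarrow> mat4" where
  "edges_matrix = (\<lambda>(x, y, u, t, v, s). \<chi> i j. if i = j then 0
     else if {i, j} = {0, 1} then x else if {i, j} = {2, 3} then y
     else if {i, j} = {0, 2} then u else if {i, j} = {1, 3} then t
     else if {i, j} = {1, 2} then v else s)"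

lemma edges_matrix_edges:
  assumes "A \<in> metric_matrices d"
  shows "edges_matrix (edges A) = A"
  unfolding vec_eq_iff all_4
  by (simp add: edges_matrix_def edges_def doubleton_eq_iff metric_matrix_symmetric[OF assms])

lemma edges_edges_matrix: "edges (edges_matrix e) = e"
  by (cases e rule: prod_cases6) (simp add: edges_matrix_def edges_def doubleton_eq_iff)

lemma edges_matrix_metric:
  assumes "e \<in> metric_edges d"
  shows "edges_matrix e \<in> metric_matrices d"
proof -
  obtain x y u t v s where e: "e = (x, y, u, t, v, s)"
    by (cases e rule: prod_cases6)
  have range: "1 \<le> x" "1 \<le> y" "1 \<le> u" "1 \<le> t" "1 \<le> v" "1 \<le> s" "x \<le> d" "y \<le> d" "u \<le> d" "t \<le> d" "v \<le> d" "s \<le> d"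
    using assms by (auto simp: e metric_edges_def)
  have triangles: "x < u + v" "x < v + u" "u < x + v" "u < v + x" "v < x + u" "v < u + x"
    "x < s + t" "x < t + s" "s < x + t" "s < t + x" "t < x + s" "t < s + x"
    "y < u + s" "y < s + u" "u < y + s" "u < s + y" "s < y + u" "s < u + y"
    "y < v + t" "y < t + v" "v < y + t" "v < t + y" "t < y + v" "t < v + y"
    using assms by (auto simp: e metric_edges_def tri_def)
  let ?B = "edges_matrix e"
  have entries: "?B $ 0 $ 0 = 0" "?B $ 0 $ 1 = x" "?B $ 0 $ 2 = u" "?B $ 0 $ 3 = s"
    "?B $ 1 $ 0 = x" "?B $ 1 $ 1 = 0" "?B $ 1 $ 2 = v" "?B $ 1 $ 3 = t"
    "?B $ 2 $ 0 = u" "?B $ 2 $ 1 = v" "?B $ 2 $ 2 = 0" "?B $ 2 $ 3 = y"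
    "?B $ 3 $ 0 = s" "?B $ 3 $ 1 = t" "?B $ 3 $ 2 = y" "?B $ 3 $ 3 = 0"
    by (simp_all add: e edges_matrix_def doubleton_eq_iff)
  have distinct: "(0::4) \<noteq> 1" "(0::4) \<noteq> 2" "(0::4) \<noteq> 3" "(1::4) \<noteq> 2" "(1::4) \<noteq> 3" "(2::4) \<noteq> 3"
    by simp_all
  show ?thesis
    unfolding metric_matrices_iff all_4 entries
    by (simp only: range triangles distinct distinct[symmetric] simp_thms)
qed

lemma card_metric_edges:
  "card {A \<in> metric_matrices d. P (edges A)} = card {e \<in> metric_edges d. P e}"
proof (rule bij_betw_same_card)
  show "bij_betw edges {A \<in> metric_matrices d. P (edges A)} {e \<in> metric_edges d. P e}"
    by (rule bij_betw_byWitness[where f' = edges_matrix])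
      (auto simp: edges_matrix_edges edges_edges_matrix edges_matrix_metric edges_metric_matrix)
qed

lemma card_metric_matrices: "card (metric_matrices d) = card (metric_edges d)"
  using card_metric_edges[of d "\<lambda>_. True"] by simp

lemma card_fixed_matrices:
  assumes "\<And>A. A \<in> metric_matrices d \<Longrightarrow>
    permute_matrix \<tau> A = A \<longleftrightarrow> P (A $ 0 $ 1) (A $ 2 $ 3) (A $ 0 $ 2) (A $ 1 $ 3) (A $ 1 $ 2) (A $ 0 $ 3)"
  shows "num_fixed d \<tau> =
    card {(x, y, u, t, v, s). (x, y, u, t, v, s) \<in> metric_edges d \<and> P x y u t v s}"
proof -
  have "fixed_matrices d \<tau> = {A \<in> metric_matrices d. (\<lambda>(x, y, u, t, v, s). P x y u t v s) (edges A)}"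
    using assms by (auto simp: fixed_matrices_def edges_def)
  then have "num_fixed d \<tau> = card {e \<in> metric_edges d. (\<lambda>(x, y, u, t, v, s). P x y u t v s) e}"
    by (simp only: card_metric_edges)
  also have "{e \<in> metric_edges d. (\<lambda>(x, y, u, t, v, s). P x y u t v s) e} =
     {(x, y, u, t, v, s). (x, y, u, t, v, s) \<in> metric_edges d \<and> P x y u t v s}"
    by auto
  finally show ?thesis .
qed

text \<open>A matrix is fixed by a permutation if and only if its entries are constant on each cycle of
the induced permutation of the six edges. The next four lemmas list these cycles for the
representatives.\<close>

lemma card_fixed_transposition:
  "num_fixed d (transpose 0 1) =
   card {(x, y, u, t, v, s). (x, y, u, t, v, s) \<in> metric_edges d \<and> u = v \<and> t = s}"
proof (rule card_fixed_matrices)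
  fix A assume "A \<in> metric_matrices d"
  note symmetric = metric_matrix_symmetric[OF this]
  let ?x = "A $ 0 $ 1" and ?y = "A $ 2 $ 3" and ?u = "A $ 0 $ 2" and ?t = "A $ 1 $ 3"
    and ?v = "A $ 1 $ 2" and ?s = "A $ 0 $ 3"
  show "permute_matrix (transpose 0 1) A = A \<longleftrightarrow>
    ?u = ?v \<and> ?t = ?s"
    unfolding vec_eq_iff all_4 permute_matrix_nth by (simp add: symmetric) metis
qed

lemma card_fixed_double_transposition:
  "num_fixed d double_transposition =
   card {(x, y, u, t, v, s). (x, y, u, t, v, s) \<in> metric_edges d \<and> u = t \<and> v = s}"
proof (rule card_fixed_matrices)
  fix A assume "A \<in> metric_matrices d"
  note symmetric = metric_matrix_symmetric[OF this]
  let ?x = "A $ 0 $ 1" and ?y = "A $ 2 $ 3" and ?u = "A $ 0 $ 2" and ?t = "A $ 1 $ 3"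
    and ?v = "A $ 1 $ 2" and ?s = "A $ 0 $ 3"
  show "permute_matrix double_transposition A = A \<longleftrightarrow>
    ?u = ?t \<and> ?v = ?s"
    unfolding vec_eq_iff all_4 permute_matrix_nth by (simp add: symmetric) metis
qed

lemma card_fixed_three_cycle:
  "num_fixed d three_cycle =
   card {(x, y, u, t, v, s). (x, y, u, t, v, s) \<in> metric_edges d \<and> x = u \<and> u = v \<and> y = t \<and> t = s}"
proof (rule card_fixed_matrices)
  fix A assume "A \<in> metric_matrices d"
  note symmetric = metric_matrix_symmetric[OF this]
  let ?x = "A $ 0 $ 1" and ?y = "A $ 2 $ 3" and ?u = "A $ 0 $ 2" and ?t = "A $ 1 $ 3"
    and ?v = "A $ 1 $ 2" and ?s = "A $ 0 $ 3"
  show "permute_matrix three_cycle A = A \<longleftrightarrow>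
    ?x = ?u \<and> ?u = ?v \<and> ?y = ?t \<and> ?t = ?s"
    unfolding vec_eq_iff all_4 permute_matrix_nth by (simp add: symmetric) metis
qed

lemma card_fixed_four_cycle:
  "num_fixed d four_cycle =
   card {(x, y, u, t, v, s). (x, y, u, t, v, s) \<in> metric_edges d \<and> x = v \<and> v = y \<and> y = s \<and> u = t}"
proof (rule card_fixed_matrices)
  fix A assume "A \<in> metric_matrices d"
  note symmetric = metric_matrix_symmetric[OF this]
  let ?x = "A $ 0 $ 1" and ?y = "A $ 2 $ 3" and ?u = "A $ 0 $ 2" and ?t = "A $ 1 $ 3"
    and ?v = "A $ 1 $ 2" and ?s = "A $ 0 $ 3"
  show "permute_matrix four_cycle A = A \<longleftrightarrow>
    ?x = ?v \<and> ?v = ?y \<and> ?y = ?s \<and> ?u = ?t"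
    unfolding vec_eq_iff all_4 permute_matrix_nth by (simp add: symmetric) metis
qed

text \<open>A class of matrices with entries up to $d + 1$ either has no entry $d + 1$, and is then
literally also a class for the bound $d$, or its diameter is $d + 1$.\<close>

lemma alpha_hat_le_Suc: "alpha_hat_le (Suc d) = alpha_hat_le d + alpha_hat (Suc d)"
proof -
  let ?M = "metric_matrices d" and ?M' = "metric_matrices (Suc d)"
  let ?top = "{C \<in> iso_classes (Suc d). \<forall>A\<in>C. diameter4 A = Suc d}"
  have sub: "?M \<subseteq> ?M'"
    unfolding metric_matrices_iff subset_iff by (meson le_SucI)
  have diam: "diameter4 A = Suc d \<longleftrightarrow> A \<notin> ?M" if "A \<in> ?M'" for A
  proof -
    let ?S = "{A $ i $ j | i j. True}"
    have "?S = (\<lambda>(i, j). A $ i $ j) ` UNIV"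
      by auto
    then have "finite ?S"
      by (metis finite finite_imageI)
    moreover have "?S \<noteq> {}" by blast
    moreover have bound: "A $ i $ j \<le> Suc d" for i j
      using that unfolding metric_matrices_iff by (cases "i = j") simp_all
    ultimately have "diameter4 A = Suc d \<longleftrightarrow> Suc d \<in> ?S"
      unfolding diameter4_def using Max_eq_iff[of ?S "Suc d"] by blast
    also have "\<dots> \<longleftrightarrow> (\<exists>i j. A $ i $ j = Suc d)"
      unfolding mem_Collect_eq by (metis (no_types))
    also have "\<dots> \<longleftrightarrow> \<not> (\<forall>i j. A $ i $ j \<le> d)"
      using bound by (metis le_Suc_eq not_less_eq_eq)
    also have "(\<forall>i j. A $ i $ j \<le> d) \<longleftrightarrow> (\<forall>i j. i \<noteq> j \<longrightarrow> A $ i $ j \<le> d)"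
      using metric_matrix_symmetric(7)[OF that] by (metis zero_le)
    also have "\<dots> \<longleftrightarrow> A \<in> ?M"
      using that by (simp add: metric_matrices_def)
    finally show ?thesis .
  qed
  have class_eq: "iso_rel (Suc d) `` {A} = iso_rel d `` {A}" if "A \<in> ?M" for A
  proof -
    have "B \<in> ?M" if "isomorphic A B" for B
    proof -
      from that obtain \<tau> where "\<tau> permutes UNIV" "B = permute_matrix \<tau> A"
        by (auto simp: isomorphic_def vec_eq_iff)
      then show ?thesis
        using \<open>A \<in> ?M\<close> permute_matrix_metric permutes_bij by blast
    qed
    then show ?thesis
      using that sub by (auto simp: iso_rel_def)
  qed
  have top: "iso_rel (Suc d) `` {A} \<in> ?top \<longleftrightarrow> A \<notin> ?M" if "A \<in> ?M'" for A
  proof -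
    have "(\<forall>B\<in>iso_rel (Suc d) `` {A}. diameter4 B = Suc d) \<longleftrightarrow> diameter4 A = Suc d"
      using that equiv_class_self[OF equiv_iso_rel that]
      by (auto simp: iso_rel_def dest: diameter4_isomorphic)
    then show ?thesis
      using that by (auto simp: diam iso_classes_def quotient_def)
  qed
  have union: "iso_classes (Suc d) = iso_classes d \<union> ?top"
  proof -
    have "C \<in> iso_classes (Suc d) \<longleftrightarrow> C \<in> iso_classes d \<or> C \<in> ?top" for C
    proof
      assume "C \<in> iso_classes (Suc d)"
      then obtain A where A: "A \<in> ?M'" "C = iso_rel (Suc d) `` {A}"
        by (auto simp: iso_classes_def quotient_def)
      show "C \<in> iso_classes d \<or> C \<in> ?top"
      proof (cases "A \<in> ?M")
        case True
        then have "C \<in> iso_classes d"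
          using A class_eq unfolding iso_classes_def quotient_def by auto
        then show ?thesis ..
      next
        case False
        then show ?thesis
          using A top by blast
      qed
    next
      assume "C \<in> iso_classes d \<or> C \<in> ?top"
      then show "C \<in> iso_classes (Suc d)"
        using class_eq sub unfolding iso_classes_def quotient_def by blast
    qed
    then show ?thesis by blast
  qed
  have disjoint: "iso_classes d \<inter> ?top = {}"
  proof -
    have "C \<notin> ?top" if "C \<in> iso_classes d" for C
    proof -
      from that obtain A where "A \<in> ?M" "C = iso_rel d `` {A}"
        by (auto simp: iso_classes_def quotient_def)
      then show ?thesis
        using top[of A] class_eq sub by auto
    qed
    then show ?thesis by blast
  qed
  have "finite (iso_classes (Suc d))"
    unfolding iso_classes_def
    by (rule finite_quotient[OF finite_metric_matrices]) (auto simp: iso_rel_def)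
  then have "finite (iso_classes d \<union> ?top)"
    by (simp only: union[symmetric])
  then have "finite (iso_classes d)" "finite ?top"
    by (simp_all only: finite_Un)
  then have "card (iso_classes d \<union> ?top) = card (iso_classes d) + card ?top"
    using disjoint by (rule card_Un_disjoint)
  then show ?thesis
    by (simp only: alpha_hat_le_def alpha_hat_def union[symmetric])
qed

section \<open>Gap sums\<close>

lemma sum_atLeast1_add:
  fixes F :: "nat \<Rightarrow> 'a::comm_monoid_add"
  shows "(\<Sum>m\<in>{1..h + e}. F m) = (\<Sum>m\<in>{1..h}. F m) + (\<Sum>j\<in>{1..e}. F (h + j))"
  by (induction e) (simp_all add: add.assoc)

text \<open>Here $h = \lceil n / 2 \rceil$ and $e = \lfloor n / 2 \rfloor$. The two cases carry the
parity of $n$ as a value of $(-1)^n$, so that closed forms for both parities can be checked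
together.\<close>

lemma halves:
  fixes n :: nat
  obtains h e where "n = h + e" "h = e \<and> (-1 :: real) ^ n = 1 \<or> h = Suc e \<and> (-1 :: real) ^ n = -1"
proof (cases "even n")
  case True
  then obtain e where "n = 2 * e" by blast
  then show ?thesis using that[of e e] by simp
next
  case False
  then obtain e where "n = 2 * e + 1" using oddE by blast
  then show ?thesis using that[of "Suc e" e] by simp
qed

text \<open>The first $\lceil n / 2 \rceil$ odd numbers are at most $n$ and the later ones are at least
$n$.\<close>

lemma sum_min_split:
  assumes "n = h + e" "h = e \<or> h = Suc e"
  shows "(\<Sum>m\<in>{1..n}. F m (min (2 * m - 1) n)) =
     (\<Sum>m\<in>{1..h}. F m (2 * m - 1)) + (\<Sum>j\<in>{1..e}. F (h + j) n)"
proof -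
  have "(\<Sum>m\<in>{1..h}. F m (min (2 * m - 1) n)) = (\<Sum>m\<in>{1..h}. F m (2 * m - 1))"
    using assms by (intro sum.cong refl) (auto simp: min_def)
  moreover have "(\<Sum>j\<in>{1..e}. F (h + j) (min (2 * (h + j) - 1) n)) = (\<Sum>j\<in>{1..e}. F (h + j) n)"
    using assms by (intro sum.cong refl) (auto simp: min_def)
  ultimately show ?thesis
    using sum_atLeast1_add[of "\<lambda>m. F m (min (2 * m - 1) n)" h e] assms(1) by simp
qed

lemma sum_odd: "(\<Sum>m\<in>{1..h}. real (2 * m - 1)) = real h ^ 2"
  by (induction h) (simp_all add: power2_eq_square algebra_simps)

lemma sum_odd_squares: "(\<Sum>m\<in>{1..h}. real (2 * m - 1) ^ 2) = real h * (4 * real h ^ 2 - 1) / 3"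
  by (induction h) (simp_all add: power2_eq_square field_simps)

lemma sum_times_odd: "(\<Sum>m\<in>{1..h}. real m * real (2 * m - 1)) = real h * (real h + 1) * (4 * real h - 1) / 6"
  by (induction h) (simp_all add: power2_eq_square field_simps)

lemma sum_shifted: "(\<Sum>j\<in>{1..e}. real (h + j)) = real e * real h + real e * (real e + 1) / 2"
  by (induction e) (simp_all add: field_simps)

lemma sum_min:
  "real (\<Sum>m\<in>{1..n}. min (2 * m - 1) n) = (6 * real n ^ 2 + 1 - (-1) ^ n) / 8"
proof -
  obtain h e where n: "n = h + e" "h = e \<and> (-1 :: real) ^ n = 1 \<or> h = Suc e \<and> (-1 :: real) ^ n = -1"
    by (rule halves)
  then have "(\<Sum>m\<in>{1..n}. real (min (2 * m - 1) n)) = real h ^ 2 + real e * real n"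
    using sum_min_split[of n h e "\<lambda>m k. real k"] unfolding sum_odd by auto
  then show ?thesis
    using n(2) by (auto simp: n(1) power2_eq_square field_simps)
qed

lemma sum_min_squares:
  "real (\<Sum>m\<in>{1..n}. min (2 * m - 1) n ^ 2) = (8 * real n ^ 3 + real n - 3 * real n * (-1) ^ n) / 12"
proof -
  obtain h e where n: "n = h + e" "h = e \<and> (-1 :: real) ^ n = 1 \<or> h = Suc e \<and> (-1 :: real) ^ n = -1"
    by (rule halves)
  then have "(\<Sum>m\<in>{1..n}. real (min (2 * m - 1) n) ^ 2) = real h * (4 * real h ^ 2 - 1) / 3
      + real e * real n ^ 2"
    using sum_min_split[of n h e "\<lambda>m k. real k ^ 2"] unfolding sum_odd_squares by auto
  then show ?thesis
    using n(2) by (auto simp: n(1) power2_eq_square power3_eq_cube field_simps)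
qed

lemma sum_times_min:
  "real (\<Sum>m\<in>{1..n}. m * min (2 * m - 1) n) =
     (22 * real n ^ 3 + 18 * real n ^ 2 - real n + 3 - 3 * (real n + 1) * (-1) ^ n) / 48"
proof -
  obtain h e where n: "n = h + e" "h = e \<and> (-1 :: real) ^ n = 1 \<or> h = Suc e \<and> (-1 :: real) ^ n = -1"
    by (rule halves)
  then have "(\<Sum>m\<in>{1..n}. real m * real (min (2 * m - 1) n)) =
      real h * (real h + 1) * (4 * real h - 1) / 6 + (real e * real h + real e * (real e + 1) / 2) * real n"
    using sum_min_split[of n h e "\<lambda>m k. real m * real k"]
    unfolding sum_times_odd sum_distrib_right[symmetric] sum_shifted by auto
  then show ?thesis
    using n(2) by (auto simp: n(1) power2_eq_square power3_eq_cube field_simps)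
qed

lemma sum_upper_half:
  "real (\<Sum>m\<in>{1..n}. if 2 * m > n then m else 0) =
     (6 * real n ^ 2 + 6 * real n + 1 - (2 * real n + 1) * (-1) ^ n) / 16"
proof -
  obtain h e where n: "n = h + e" "h = e \<and> (-1 :: real) ^ n = 1 \<or> h = Suc e \<and> (-1 :: real) ^ n = -1"
    by (rule halves)
  have "(\<Sum>m\<in>{1..n}. if 2 * m > n then m else 0) =
      (\<Sum>m\<in>{1..e}. if 2 * m > n then m else 0) + (\<Sum>j\<in>{1..h}. if 2 * (e + j) > n then e + j else 0)"
    using sum_atLeast1_add[of "\<lambda>m. if 2 * m > n then m else 0" e h] by (simp add: n(1) add.commute)
  also have "\<dots> = 0 + (\<Sum>j\<in>{1..h}. e + j)"
    using n by (intro arg_cong2[where f = "(+)"] sum.neutral sum.cong refl ballI) auto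
  finally have "real (\<Sum>m\<in>{1..n}. if 2 * m > n then m else 0) = (\<Sum>j\<in>{1..h}. real (e + j))"
    by simp
  also have "\<dots> = real h * real e + real h * (real h + 1) / 2"
    by (rule sum_shifted)
  finally show ?thesis
    using n(2) by (auto simp: n(1) power2_eq_square field_simps)
qed

text \<open>A pair $(a, b)$ enters through its minimum $m$ and through $n = d - |a - b|$, because the
number of third sides depends on these two. With the numbers $m$ and $n$ as coordinates, the range
is just $1 \le m \le n \le d$.\<close>

definition gap_sum :: "nat \<Rightarrow> (nat \<Rightarrow> nat \<Rightarrow> nat) \<Rightarrow> nat" where
  "gap_sum d \<phi> = (\<Sum>a\<in>{1..d}. \<Sum>b\<in>{1..d}. \<phi> (min a b) (d - (max a b - min a b)))"

text \<open>The pairs with $a \le b$ and those with $a \ge b$ contribute equally, and the diagonal,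
where $n = d$, is counted in both.\<close>

lemma gap_sum_eq:
  "gap_sum d \<phi> + (\<Sum>m\<in>{1..d}. \<phi> m d) = 2 * (\<Sum>n\<in>{1..d}. \<Sum>m\<in>{1..n}. \<phi> m n)"
proof -
  define g where "g = (\<lambda>(a, b). \<phi> (min a b) (d - (max a b - min a b)))"
  let ?low = "{(a, b). 1 \<le> a \<and> a \<le> b \<and> b \<le> d}"
  let ?high = "{(a, b). 1 \<le> b \<and> b \<le> a \<and> a \<le> d}"
  have fin: "finite ?low" "finite ?high"
    by (rule finite_subset[of _ "{1..d} \<times> {1..d}"]; auto)+
  have low: "sum g ?low = (\<Sum>n\<in>{1..d}. \<Sum>m\<in>{1..n}. \<phi> m n)"
  proof -
    have "sum g ?low = (\<Sum>(n, m)\<in>(SIGMA n:{1..d}. {1..n}). \<phi> m n)"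
      by (rule sum.reindex_bij_witness[where
            i = "\<lambda>(n, m). (m, m + (d - n))" and j = "\<lambda>(a, b). (d - (b - a), a)"])
        (auto simp: g_def)
    then show ?thesis
      by (simp add: sum.Sigma)
  qed
  have high: "sum g ?high = sum g ?low"
    by (rule sum.reindex_bij_witness[where i = prod.swap and j = prod.swap])
      (auto simp: g_def min.commute max.commute)
  have diagonal: "sum g (?low \<inter> ?high) = (\<Sum>m\<in>{1..d}. \<phi> m d)"
    by (rule sum.reindex_bij_witness[where i = "\<lambda>m. (m, m)" and j = fst]) (auto simp: g_def)
  have "gap_sum d \<phi> = sum g ({1..d} \<times> {1..d})"
    by (simp add: gap_sum_def g_def sum.cartesian_product)
  also have "{1..d} \<times> {1..d} = ?low \<union> ?high"
    by auto
  finally show ?thesis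
    using sum.union_inter[OF fin, of g] low high diagonal by simp
qed

lemma gap_sum_real:
  assumes "\<And>n. n \<le> d \<Longrightarrow> real (\<Sum>m\<in>{1..n}. \<phi> m n) = \<Phi> n"
  shows "real (gap_sum d \<phi>) = 2 * (\<Sum>n\<in>{1..d}. \<Phi> n) - \<Phi> d"
proof -
  have "real (gap_sum d \<phi>) + real (\<Sum>m\<in>{1..d}. \<phi> m d) =
      2 * (\<Sum>n\<in>{1..d}. real (\<Sum>m\<in>{1..n}. \<phi> m n))"
    using gap_sum_eq[of d \<phi>, THEN arg_cong[where f = real]] by simp
  then show ?thesis
    using assms by (simp only: order_refl) (simp add: assms)
qed

text \<open>In each of the following evaluations the sum over $m$ is known, and the sum over $n$ follows
by induction on its upper limit.\<close>

lemma gap_sum_min: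
  "real (gap_sum d (\<lambda>m n. min (2 * m - 1) n)) = (real d ^ 3 + real d) / 2"
proof -
  have "(\<Sum>n\<in>{1..d}. (6 * real n ^ 2 + 1 - (-1) ^ n) / 8) =
      (4 * real d ^ 3 + 6 * real d ^ 2 + 4 * real d + 1 - (-1) ^ d) / 16"
    by (induction d) (simp_all add: power2_eq_square power3_eq_cube field_simps)
  then show ?thesis
    by (subst gap_sum_real[OF sum_min]) (simp add: field_simps)
qed

lemma gap_sum_min_squares:
  "real (gap_sum d (\<lambda>m n. min (2 * m - 1) n ^ 2)) = (8 * real d ^ 4 + 10 * real d ^ 2 + 3
      - 3 * (-1) ^ d) / 24"
proof -
  have "(\<Sum>n\<in>{1..d}. (8 * real n ^ 3 + real n - 3 * real n * (-1) ^ n) / 12) =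
      (8 * real d ^ 4 + 16 * real d ^ 3 + 10 * real d ^ 2 + 2 * real d + 3 - (6 * real d
          + 3) * (-1) ^ d) / 48"
    by (induction d) (simp_all add: eval_nat_numeral field_simps)
  then show ?thesis
    by (subst gap_sum_real[OF sum_min_squares]) (simp add: field_simps)
qed

lemma gap_sum_times_min:
  "real (gap_sum d (\<lambda>m n. m * min (2 * m - 1) n)) =
     (22 * real d ^ 4 + 24 * real d ^ 3 + 20 * real d ^ 2 + 24 * real d + 3 - 3 * (-1) ^ d) / 96"
proof -
  have "(\<Sum>n\<in>{1..d}. (22 * real n ^ 3 + 18 * real n ^ 2 - real n + 3 - 3 * (real n + 1) * (-1) ^ n) / 48) =
      (22 * real d ^ 4 + 68 * real d ^ 3 + 56 * real d ^ 2 + 22 * real d + 9 - (6 * real d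
          + 9) * (-1) ^ d) / 192"
    by (induction d) (simp_all add: eval_nat_numeral field_simps)
  then show ?thesis
    by (subst gap_sum_real[OF sum_times_min]) (simp add: field_simps)
qed

lemma gap_sum_upper_half:
  "real (gap_sum d (\<lambda>m n. if 2 * m > n then m else 0)) =
     (4 * real d ^ 3 + 6 * real d ^ 2 + 4 * real d + 1 - (-1) ^ d) / 16"
proof -
  have "(\<Sum>n\<in>{1..d}. (6 * real n ^ 2 + 6 * real n + 1 - (2 * real n + 1) * (-1) ^ n) / 16) =
      (2 * real d ^ 3 + 6 * real d ^ 2 + 5 * real d + 1 - (real d + 1) * (-1) ^ d) / 16"
    by (induction d) (simp_all add: eval_nat_numeral field_simps)
  then show ?thesis
    by (subst gap_sum_real[OF sum_upper_half]) (simp add: field_simps)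
qed

lemma sum_squares: "(\<Sum>m\<in>{1..n}. real m ^ 2) = (2 * real n ^ 3 + 3 * real n ^ 2 + real n) / 6"
  by (induction n) (simp_all add: eval_nat_numeral field_simps)

lemma gap_sum_squares:
  "real (gap_sum d (\<lambda>m n. m ^ 2)) = (real d ^ 4 + 2 * real d ^ 3 + 2 * real d ^ 2 + real d) / 6"
proof -
  have inner: "real (\<Sum>m\<in>{1..n}. m ^ 2) = (2 * real n ^ 3 + 3 * real n ^ 2 + real n) / 6" for n
    using sum_squares[of n] by simp
  have "(\<Sum>n\<in>{1..d}. (2 * real n ^ 3 + 3 * real n ^ 2 + real n) / 6) =
      (real d ^ 4 + 4 * real d ^ 3 + 5 * real d ^ 2 + 2 * real d) / 12"
    by (induction d) (simp_all add: eval_nat_numeral field_simps)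
  then show ?thesis
    by (subst gap_sum_real[OF inner]) (simp add: field_simps)
qed

text \<open>Both minima agree unless $2m - 1$ exceeds $n$, in which case the second one is $n$. This
reduces the product to \<open>sum_min_squares\<close> and to the partial sums \<open>F\<close> of \<open>min (2 m - 1) d\<close>, which
change their form at half of $d$.\<close>

lemma gap_sum_min_min:
  "real (gap_sum d (\<lambda>m n. min (2 * m - 1) d * min (2 * m - 1) n)) =
     (74 * real d ^ 4 + 58 * real d ^ 2 + 21 - (18 * real d ^ 2 + 21) * (-1) ^ d) / 192"
proof -
  define F where "F n = (\<Sum>m\<in>{1..n}. real (min (2 * m - 1) d))" for n
  let ?f = "\<lambda>n. (6 * real n ^ 2 + 1 - (-1) ^ n) / 8"
  let ?g = "\<lambda>n. (8 * real n ^ 3 + real n - 3 * real n * (-1) ^ n) / 12"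
  have inner: "real (\<Sum>m\<in>{1..n}. min (2 * m - 1) d * min (2 * m - 1) n) =
      ?g n + real n * (F n - ?f n)" if "n \<le> d" for n
  proof -
    have "real (min (2 * m - 1) d * min (2 * m - 1) n) =
        real (min (2 * m - 1) n ^ 2) + real n * (real (min (2 * m - 1) d) - real (min (2 * m - 1) n))" for m
    proof (cases "2 * m - 1 \<le> n")
      case True
      then show ?thesis
        using that by (simp add: min_def power2_eq_square)
    next
      case False
      then have "min (2 * m - 1) n = n" by simp
      then show ?thesis
        by (simp add: power2_eq_square algebra_simps)
    qed
    then have "real (\<Sum>m\<in>{1..n}. min (2 * m - 1) d * min (2 * m - 1) n) =
        real (\<Sum>m\<in>{1..n}. min (2 * m - 1) n ^ 2) + real n * (F n - real (\<Sum>m\<in>{1..n}. min (2 * m - 1) n))"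
      by (simp only: of_nat_sum sum.distrib sum_distrib_left sum_subtractf F_def right_diff_distrib)
    then show ?thesis
      by (simp only: sum_min sum_min_squares)
  qed
  have sum_F: "(\<Sum>n\<in>{1..d}. real n * F n) =
     (82 * real d ^ 4 + 144 * real d ^ 3 + 74 * real d ^ 2 + 24 * real d + 9
        - (18 * real d ^ 2 + 24 * real d + 9) * (-1) ^ d) / 384"
  proof -
    obtain h e where d: "d = h + e" "h = e \<and> (-1 :: real) ^ d = 1 \<or> h = Suc e \<and> (-1 :: real) ^ d = -1"
      by (rule halves)
    have low: "F n = real n ^ 2" if "n \<le> h" for n
    proof -
      have "F n = (\<Sum>m\<in>{1..n}. real (2 * m - 1))"
        unfolding F_def using d that by (intro sum.cong refl) (auto simp: min_def)
      then show ?thesis by (simp only: sum_odd)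
    qed
    have high: "F (h + j) = real h ^ 2 + real j * real d" for j
    proof -
      have "F (h + j) = F h + (\<Sum>i\<in>{1..j}. real (min (2 * (h + i) - 1) d))"
        unfolding F_def by (rule sum_atLeast1_add)
      also have "(\<Sum>i\<in>{1..j}. real (min (2 * (h + i) - 1) d)) = (\<Sum>i\<in>{1..j}. real d)"
        using d by (intro sum.cong refl) (auto simp: min_def)
      finally show ?thesis
        by (simp add: low)
    qed
    have "(\<Sum>n\<in>{1..d}. real n * F n) =
        (\<Sum>n\<in>{1..h}. real n * F n) + (\<Sum>j\<in>{1..e}. real (h + j) * F (h + j))"
      unfolding d(1) by (rule sum_atLeast1_add)
    also have "(\<Sum>n\<in>{1..h}. real n * F n) = (\<Sum>n\<in>{1..h}. real n ^ 3)"
      by (intro sum.cong refl) (simp add: low power2_eq_square power3_eq_cube)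
    also have "\<dots> = real h ^ 2 * (real h + 1) ^ 2 / 4"
      by (induction h) (simp_all add: eval_nat_numeral field_simps)
    also have "(\<Sum>j\<in>{1..e}. real (h + j) * F (h + j)) =
        (\<Sum>j\<in>{1..e}. real (h + j) * (real h ^ 2 + real j * real d))"
      by (simp only: high)
    also have "\<dots> = real e * real h ^ 3 + real e * (real e + 1) / 2 * (real h ^ 2 + real h * real d)
        + real d * real e * (real e + 1) * (2 * real e + 1) / 6"
      by (induction e) (simp_all add: eval_nat_numeral field_simps)
    finally show ?thesis
      using d(2) by (auto simp: d(1) eval_nat_numeral field_simps)
  qed
  have sum_f: "(\<Sum>n\<in>{1..k}. real n * ?f n) =
     (6 * real k ^ 4 + 12 * real k ^ 3 + 8 * real k ^ 2 + 2 * real k + 1 - (2 * real k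
         + 1) * (-1) ^ k) / 32" for k
    by (induction k) (simp_all add: eval_nat_numeral field_simps)
  have sum_g: "(\<Sum>n\<in>{1..k}. ?g n) =
      (8 * real k ^ 4 + 16 * real k ^ 3 + 10 * real k ^ 2 + 2 * real k + 3 - (6 * real k
          + 3) * (-1) ^ k) / 48" for k
    by (induction k) (simp_all add: eval_nat_numeral field_simps)
  have F_d: "F d = ?f d"
    using sum_min[of d] by (simp add: F_def)
  have "real (gap_sum d (\<lambda>m n. min (2 * m - 1) d * min (2 * m - 1) n)) =
      2 * (\<Sum>n\<in>{1..d}. ?g n + real n * (F n - ?f n)) - (?g d + real d * (F d - ?f d))"
    by (rule gap_sum_real) (rule inner)
  also have "(\<Sum>n\<in>{1..d}. ?g n + real n * (F n - ?f n)) =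
      (\<Sum>n\<in>{1..d}. ?g n) + ((\<Sum>n\<in>{1..d}. real n * F n) - (\<Sum>n\<in>{1..d}. real n * ?f n))"
    by (simp only: sum.distrib right_diff_distrib sum_subtractf)
  finally show ?thesis
    unfolding sum_F sum_f sum_g F_d by (simp add: field_simps)
qed

text \<open>For $n = d - |a - b|$ the number $m + (d - n)$ is the larger one of $a$ and $b$, so this is
the sum of $ab\,(d - |a - b|)$.\<close>

lemma gap_sum_product:
  "real (gap_sum d (\<lambda>m n. m * (m + (d - n)) * n)) =
     (11 * real d ^ 5 + 20 * real d ^ 4 + 15 * real d ^ 3 + 10 * real d ^ 2 + 4 * real d) / 60"
proof -
  let ?\<Phi> = "\<lambda>n. real n * (2 * real n ^ 3 + 3 * real n ^ 2 * (real d - real n) + 3 * real n ^ 2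
        + 3 * real n * (real d - real n) + real n) / 6"
  have inner: "real (\<Sum>m\<in>{1..n}. m * (m + (d - n)) * n) = ?\<Phi> n" if "n \<le> d" for n
  proof -
    have "(\<Sum>m\<in>{1..n'}. real m * (real m + c) * real n) = real n * (2 * real n' ^ 3 + 3 * real n' ^ 2 * c
        + 3 * real n' ^ 2 + 3 * real n' * c + real n') / 6" for n' :: nat and c :: real
      by (induction n') (simp_all add: eval_nat_numeral field_simps)
    from this[where n' = n and c = "real d - real n"] show ?thesis
      using that by (simp add: of_nat_diff add_diff_eq)
  qed
  have outer: "(\<Sum>n\<in>{1..k}. ?\<Phi> n) = (15 * real k ^ 4 * real d - 4 * real k ^ 5 - 10 * real k ^ 4
      + 50 * real k ^ 3 * real d
      + 45 * real k ^ 2 * real d + 10 * real k ^ 2 + 10 * real k * real d + 4 * real k) / 120" for k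
    by (induction k) (simp_all add: eval_nat_numeral field_simps)
  have "real (gap_sum d (\<lambda>m n. m * (m + (d - n)) * n)) = 2 * (\<Sum>n\<in>{1..d}. ?\<Phi> n) - ?\<Phi> d"
    by (rule gap_sum_real) (rule inner)
  then show ?thesis
    unfolding outer by (simp add: eval_nat_numeral field_simps)
qed

lemma triangular: "real (\<Sum>{1..n}) = real n * (real n + 1) / 2"
  by (induction n) (simp_all add: field_simps)

text \<open>By \<open>sum_min\<close> the inner factor is quadratic in $d - w$ up to a multiple of $(-1)^{d - w}$.
Since $(-1)^{d - w} = (-1)^d (-1)^w$, the convolution reduces to three sums over $w$ in which $d$
is a mere parameter.\<close>

lemma sum_triangular_min:
  "real (\<Sum>w\<in>{1..d}. \<Sum>{1..w} * (\<Sum>y\<in>{1..d - w}. min (2 * y - 1) (d - w))) =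
     (12 * real d ^ 5 + 30 * real d ^ 4 + 20 * real d ^ 3 - 32 * real d - 15 + 15 * (-1) ^ d) / 960"
proof -
  have "real (\<Sum>w\<in>{1..d}. \<Sum>{1..w} * (\<Sum>y\<in>{1..d - w}. min (2 * y - 1) (d - w))) =
    (\<Sum>w\<in>{1..d}. real w * (real w + 1) / 2 * ((6 * (real d - real w) ^ 2 + 1 - (-1) ^ d * (-1) ^ w) / 8))"
    unfolding of_nat_sum[of _ "{1..d}"] of_nat_mult triangular sum_min
    by (intro sum.cong refl) (auto simp: of_nat_diff minus_one_power_iff)
  also have "\<dots> = 3 / 8 * (\<Sum>w\<in>{1..d}. real w * (real w + 1) * (real d - real w) ^ 2)
      + 1 / 16 * (\<Sum>w\<in>{1..d}. real w * (real w + 1))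
      - (-1) ^ d / 16 * (\<Sum>w\<in>{1..d}. real w * (real w + 1) * (-1) ^ w)"
    unfolding sum_distrib_left sum.distrib[symmetric] sum_subtractf[symmetric]
    by (intro sum.cong refl) (simp add: field_simps)
  also have "(\<Sum>w\<in>{1..k}. real w * (real w + 1) * (D - real w) ^ 2) =
      (12 * real k ^ 5 - 30 * real k ^ 4 * D + 45 * real k ^ 4 + 20 * real k ^ 3 * D ^ 2
          - 100 * real k ^ 3 * D
       + 50 * real k ^ 3 + 60 * real k ^ 2 * D ^ 2 - 90 * real k ^ 2 * D + 15 * real k ^ 2
           + 40 * real k * D ^ 2
       - 20 * real k * D - 2 * real k) / 60" for k and D :: real
    by (induction k) (simp_all add: eval_nat_numeral field_simps)
  also have "(\<Sum>w\<in>{1..k}. real w * (real w + 1)) = real k * (real k + 1) * (real k + 2) / 3" for k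
    by (induction k) (simp_all add: eval_nat_numeral field_simps)
  also have "(\<Sum>w\<in>{1..k}. real w * (real w + 1) * (-1) ^ w) =
      ((2 * real k ^ 2 + 4 * real k + 1) * (-1) ^ k - 1) / 4" for k
    by (induction k) (simp_all add: eval_nat_numeral field_simps)
  finally show ?thesis
    by (cases "even d") (simp_all add: eval_nat_numeral field_simps)
qed

section \<open>Metric edge tuples of a given diameter\<close>

text \<open>In the following lemmas the predicate says which edges have the maximal length $d$.\<close>

definition edge_count :: "nat \<Rightarrow> (nat \<Rightarrow> nat \<Rightarrow> nat \<Rightarrow> nat \<Rightarrow> nat \<Rightarrow> nat \<Rightarrow> bool) \<Rightarrow> nat" where
  "edge_count d P = card {(x, y, u, t, v, s). (x, y, u, t, v, s) \<in> metric_edges d \<and> P x y u t v s}"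

lemma finite_edge_set [simp]: "finite {(x, y, u, t, v, s). (x, y, u, t, v, s) \<in> metric_edges d
    \<and> P x y u t v s}"
  by (rule finite_subset[OF _ finite_metric_edges[of d]]) auto

lemma edge_count_or:
  assumes "\<And>x y u t v s. R x y u t v s \<longleftrightarrow> P x y u t v s \<or> Q x y u t v s"
    and "\<And>x y u t v s. S x y u t v s \<longleftrightarrow> P x y u t v s \<and> Q x y u t v s"
  shows "edge_count d R + edge_count d S = edge_count d P + edge_count d Q"
proof -
  let ?E = "\<lambda>P. {(x, y, u, t, v, s). (x, y, u, t, v, s) \<in> metric_edges d \<and> P x y u t v s}"
  have "?E R = ?E P \<union> ?E Q" and "?E S = ?E P \<inter> ?E Q"
    using assms by auto
  then show ?thesis
    using card_Un_Int[of "?E P" "?E Q"] by (simp add: edge_count_def)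
qed

lemma tri_commute: "tri a b c \<longleftrightarrow> tri b a c" "tri a b c \<longleftrightarrow> tri a c b"
  by (auto simp: tri_def)

text \<open>The next four lemmas are relabellings of the vertices, seen on the edges: they permute the
three pairs of opposite edges, or exchange the two edges in two of the pairs.\<close>

lemma edge_count_rotate:
  assumes "\<And>x y u t v s. P x y u t v s \<longleftrightarrow> Q u t v s x y"
  shows "edge_count d P = edge_count d Q"
  unfolding edge_count_def
  by (rule bij_betw_same_card[OF bij_betw_byWitness[
          where f = "\<lambda>(x, y, u, t, v, s). (u, t, v, s, x, y)"
          and f' = "\<lambda>(u, t, v, s, x, y). (x, y, u, t, v, s)"]])
    (auto simp: assms metric_edges_def tri_commute)

lemma edge_count_swap_opposite:
  assumes "\<And>x y u t v s. P x y u t v s \<longleftrightarrow> Q y x t u v s"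
  shows "edge_count d P = edge_count d Q"
  unfolding edge_count_def
  by (rule bij_betw_same_card[OF bij_betw_byWitness[
          where f = "\<lambda>(x, y, u, t, v, s). (y, x, t, u, v, s)"
          and f' = "\<lambda>(x, y, u, t, v, s). (y, x, t, u, v, s)"]])
    (auto simp: assms metric_edges_def tri_commute)

lemma edge_count_swap_crossing:
  assumes "\<And>x y u t v s. P x y u t v s \<longleftrightarrow> Q x y t u s v"
  shows "edge_count d P = edge_count d Q"
  unfolding edge_count_def
  by (rule bij_betw_same_card[OF bij_betw_byWitness[
          where f = "\<lambda>(x, y, u, t, v, s). (x, y, t, u, s, v)"
          and f' = "\<lambda>(x, y, u, t, v, s). (x, y, t, u, s, v)"]])
    (auto simp: assms metric_edges_def tri_commute)

lemma edge_count_exchange: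
  assumes "\<And>x y u t v s. P x y u t v s \<longleftrightarrow> Q u t x y v s"
  shows "edge_count d P = edge_count d Q"
  unfolding edge_count_def
  by (rule bij_betw_same_card[OF bij_betw_byWitness[
          where f = "\<lambda>(x, y, u, t, v, s). (u, t, x, y, v, s)"
          and f' = "\<lambda>(x, y, u, t, v, s). (u, t, x, y, v, s)"]])
    (auto simp: assms metric_edges_def tri_commute)

lemma edge_count_eq_card:
  assumes "\<And>x y u t v s. (x, y, u, t, v, s) \<in> metric_edges d \<Longrightarrow> P x y u t v s \<Longrightarrow>
      f (x, y, u, t, v, s) \<in> S \<and> g (f (x, y, u, t, v, s)) = (x, y, u, t, v, s)"
    and "\<And>e. e \<in> S \<Longrightarrow> f (g e) = e \<and>
      (case g e of (x, y, u, t, v, s) \<Rightarrow> (x, y, u, t, v, s) \<in> metric_edges d \<and> P x y u t v s)"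
  shows "edge_count d P = card S"
proof -
  define E where "E = {(x, y, u, t, v, s). (x, y, u, t, v, s) \<in> metric_edges d \<and> P x y u t v s}"
  have f: "f e \<in> S" "g (f e) = e" if "e \<in> E" for e
    using that assms(1) unfolding E_def by (cases e rule: prod_cases6; simp)+
  have g: "g e \<in> E" "f (g e) = e" if "e \<in> S" for e
    using assms(2)[OF that] unfolding E_def by (simp_all only: mem_Collect_eq)
  have "bij_betw f E S"
    by (rule bij_betw_byWitness[where f' = g]) (auto simp: f g)
  then show ?thesis
    unfolding edge_count_def E_def by (rule bij_betw_same_card)
qed

text \<open>The third side ranges strictly between $|a - b|$ and $a + b$ and is at most $d$. The bound
$d$ is the active one when $a + b > d$.\<close>

lemma card_third_side:
  assumes "a \<in> {1..d}" "b \<in> {1..d}"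
  shows "card {c \<in> {1..d}. tri c a b} = min (2 * min a b - 1) (d - (max a b - min a b))"
proof -
  have "{c \<in> {1..d}. tri c a b} = {max a b - min a b + 1..min d (a + b - 1)}"
    using assms by (auto simp: tri_def max_def min_def split: if_splits)
  then show ?thesis
    using assms by (auto simp: max_def min_def split: if_splits)
qed

lemma card_Sigma_square:
  assumes "\<And>a b. finite (B a b)"
  shows "card (SIGMA a:{1..d}. SIGMA b:{1..d::nat}. B a b) = (\<Sum>a\<in>{1..d}. \<Sum>b\<in>{1..d}. card (B a b))"
  by (simp add: assms)

text \<open>Now the edges of length $d$ are prescribed. In each case the remaining edges are arranged so
that, given the first ones, the later ones vary independently of each other: a constraint
$a + b > d$ with a given side $a$ leaves exactly the $a$ values from $d + 1 - a$ to $d$ for $b$.\<close>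

lemma edge_count_path:
  "edge_count d (\<lambda>x y u t v s. x = d \<and> y = d \<and> u = d) = (\<Sum>t\<in>{1..d}. t ^ 2)"
proof -
  have "edge_count d (\<lambda>x y u t v s. x = d \<and> y = d \<and> u = d) =
      card (SIGMA t:{1..d}. {d + 1 - t..d} \<times> {d + 1 - t..d})"
    by (rule edge_count_eq_card[where f = "\<lambda>(x, y, u, t, v, s). (t, v, s)"
        and g = "\<lambda>(t, v, s). (d, d, d, t, v, s)"])
      (auto simp: metric_edges_def tri_def)
  also have "\<dots> = (\<Sum>t\<in>{1..d}. t ^ 2)"
    by (auto simp: card_cartesian_product power2_eq_square intro!: sum.cong)
  finally show ?thesis .
qed

lemma edge_count_opposite:
  "edge_count d (\<lambda>x y u t v s. x = d \<and> y = d) = gap_sum d (\<lambda>m n. m ^ 2)"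
proof -
  have "edge_count d (\<lambda>x y u t v s. x = d \<and> y = d) =
      card (SIGMA u:{1..d}. SIGMA t:{1..d}. {d + 1 - min u t..d} \<times> {d + 1 - min u t..d})"
    by (rule edge_count_eq_card[where f = "\<lambda>(x, y, u, t, v, s). (u, t, v, s)"
        and g = "\<lambda>(u, t, v, s). (d, d, u, t, v, s)"])
      (auto simp: metric_edges_def tri_def)
  also have "\<dots> = gap_sum d (\<lambda>m n. m ^ 2)"
    by (auto simp: gap_sum_def card_cartesian_product power2_eq_square intro!: sum.cong)
  finally show ?thesis .
qed

lemma edge_count_adjacent:
  "edge_count d (\<lambda>x y u t v s. x = d \<and> u = d) = gap_sum d (\<lambda>m n. m * min (2 * m - 1) n)"
proof -
  have "edge_count d (\<lambda>x y u t v s. x = d \<and> u = d) =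
      card (SIGMA y:{1..d}. SIGMA t:{1..d}. {d + 1 - min y t..d} \<times> {v \<in> {1..d}. tri v y t})"
    by (rule edge_count_eq_card[where f = "\<lambda>(x, y, u, t, v, s). (y, t, s, v)"
        and g = "\<lambda>(y, t, s, v). (d, y, d, t, v, s)"])
      (auto simp: metric_edges_def tri_def)
  also have "\<dots> = (\<Sum>y\<in>{1..d}. \<Sum>t\<in>{1..d}. card ({d + 1 - min y t..d} \<times> {v \<in> {1..d}. tri v y t}))"
    by (rule card_Sigma_square) simp
  also have "\<dots> = gap_sum d (\<lambda>m n. m * min (2 * m - 1) n)"
    unfolding gap_sum_def by (intro sum.cong refl) (simp only: card_cartesian_product card_third_side, auto)
  finally show ?thesis .
qed

lemma edge_count_star:
  "edge_count d (\<lambda>x y u t v s. x = d \<and> u = d \<and> s = d) = gap_sum d (\<lambda>m n. min (2 * m - 1) n)"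
proof -
  have "edge_count d (\<lambda>x y u t v s. x = d \<and> u = d \<and> s = d) =
      card (SIGMA y:{1..d}. SIGMA t:{1..d}. {v \<in> {1..d}. tri v y t})"
    by (rule edge_count_eq_card[where f = "\<lambda>(x, y, u, t, v, s). (y, t, v)"
        and g = "\<lambda>(y, t, v). (d, y, d, t, v, d)"])
      (auto simp: metric_edges_def tri_def)
  also have "\<dots> = (\<Sum>y\<in>{1..d}. \<Sum>t\<in>{1..d}. card {v \<in> {1..d}. tri v y t})"
    by (rule card_Sigma_square) simp
  also have "\<dots> = gap_sum d (\<lambda>m n. min (2 * m - 1) n)"
    unfolding gap_sum_def by (intro sum.cong refl) (simp only: card_third_side)
  finally show ?thesis .
qed

lemma edge_count_triangle:
  "edge_count d (\<lambda>x y u t v s. x = d \<and> u = d \<and> v = d) = gap_sum d (\<lambda>m n. if 2 * m > n then m else 0)"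
proof -
  have "edge_count d (\<lambda>x y u t v s. x = d \<and> u = d \<and> v = d) =
      card (SIGMA s:{1..d}. SIGMA t:{1..d}. {y \<in> {d + 1 - min s t..d}. s + t > d})"
    by (rule edge_count_eq_card[where f = "\<lambda>(x, y, u, t, v, s). (s, t, y)"
        and g = "\<lambda>(s, t, y). (d, y, d, t, d, s)"])
      (auto simp: metric_edges_def tri_def)
  also have "\<dots> = (\<Sum>s\<in>{1..d}. \<Sum>t\<in>{1..d}. card {y \<in> {d + 1 - min s t..d}. s + t > d})"
    by (rule card_Sigma_square) simp
  also have "\<dots> = gap_sum d (\<lambda>m n. if 2 * m > n then m else 0)"
  proof -
    have "card {y \<in> {d + 1 - min s t..d}. s + t > d} =
        (if 2 * min s t > d - (max s t - min s t) then min s t else 0)"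
      if "s \<in> {1..d}" "t \<in> {1..d}" for s t
    proof -
      have "s + t > d \<longleftrightarrow> 2 * min s t > d - (max s t - min s t)"
        using that by (auto simp: min_def max_def)
      moreover have "{y \<in> {d + 1 - min s t..d}. s + t > d} =
          (if s + t > d then {d + 1 - min s t..d} else {})"
        by auto
      moreover have "min s t \<le> d"
        using that by auto
      ultimately show ?thesis
        by (simp only: if_distrib[of card] card_atLeastAtMost card.empty) simp
    qed
    then show ?thesis
      unfolding gap_sum_def by (intro sum.cong refl)
  qed
  finally show ?thesis .
qed

lemma edge_count_cycle:
  "edge_count d (\<lambda>x y u t v s. x = d \<and> y = d \<and> u = d \<and> t = d) = d ^ 2"
proof -
  have "edge_count d (\<lambda>x y u t v s. x = d \<and> y = d \<and> u = d \<and> t = d) =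
      card ({1..d} \<times> {1..d})"
    by (rule edge_count_eq_card[where f = "\<lambda>(x, y, u, t, v, s). (v, s)"
        and g = "\<lambda>(v, s). (d, d, d, d, v, s)"])
      (auto simp: metric_edges_def tri_def)
  then show ?thesis
    by (simp add: card_cartesian_product power2_eq_square)
qed

text \<open>A triangle of edges of length $d$ with one further such edge. The two free edges $a$ and $b$
always share a triangle whose third side is $d$, so only $a + b > d$ is required. Different
positions are needed because the decomposition below does not produce them in a uniform
orientation.\<close>

lemma edge_count_paw:
  "edge_count d (\<lambda>x y u t v s. x = d \<and> u = d \<and> v = d \<and> s = d) = \<Sum>{1..d}"
  "edge_count d (\<lambda>x y u t v s. x = d \<and> u = d \<and> t = d \<and> v = d) = \<Sum>{1..d}"
  "edge_count d (\<lambda>x y u t v s. x = d \<and> u = d \<and> t = d \<and> s = d) = \<Sum>{1..d}"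
  "edge_count d (\<lambda>x y u t v s. x = d \<and> y = d \<and> u = d \<and> v = d) = \<Sum>{1..d}"
  "edge_count d (\<lambda>x y u t v s. x = d \<and> y = d \<and> u = d \<and> s = d) = \<Sum>{1..d}"
proof -
  have pairs: "\<Sum>{1..d} = card (SIGMA a:{1..d}. {d + 1 - a..d})"
    by (auto intro!: sum.cong)
  show "edge_count d (\<lambda>x y u t v s. x = d \<and> u = d \<and> v = d \<and> s = d) = \<Sum>{1..d}"
    unfolding pairs
    by (rule edge_count_eq_card[where f = "\<lambda>(x, y, u, t, v, s). (t, y)"
        and g = "\<lambda>(t, y). (d, y, d, t, d, d)"])
      (auto simp: metric_edges_def tri_def)
  show "edge_count d (\<lambda>x y u t v s. x = d \<and> u = d \<and> t = d \<and> v = d) = \<Sum>{1..d}"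
    unfolding pairs
    by (rule edge_count_eq_card[where f = "\<lambda>(x, y, u, t, v, s). (s, y)"
        and g = "\<lambda>(s, y). (d, y, d, d, d, s)"])
      (auto simp: metric_edges_def tri_def)
  show "edge_count d (\<lambda>x y u t v s. x = d \<and> u = d \<and> t = d \<and> s = d) = \<Sum>{1..d}"
    unfolding pairs
    by (rule edge_count_eq_card[where f = "\<lambda>(x, y, u, t, v, s). (v, y)"
        and g = "\<lambda>(v, y). (d, y, d, d, v, d)"])
      (auto simp: metric_edges_def tri_def)
  show "edge_count d (\<lambda>x y u t v s. x = d \<and> y = d \<and> u = d \<and> v = d) = \<Sum>{1..d}"
    unfolding pairs
    by (rule edge_count_eq_card[where f = "\<lambda>(x, y, u, t, v, s). (t, s)"
        and g = "\<lambda>(t, s). (d, d, d, t, d, s)"])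
      (auto simp: metric_edges_def tri_def)
  show "edge_count d (\<lambda>x y u t v s. x = d \<and> y = d \<and> u = d \<and> s = d) = \<Sum>{1..d}"
    unfolding pairs
    by (rule edge_count_eq_card[where f = "\<lambda>(x, y, u, t, v, s). (t, v)"
        and g = "\<lambda>(t, v). (d, d, d, t, v, d)"])
      (auto simp: metric_edges_def tri_def)
qed

lemma edge_count_all_but_one:
  "edge_count d (\<lambda>x y u t v s. x = d \<and> u = d \<and> t = d \<and> v = d \<and> s = d) = d"
  "edge_count d (\<lambda>x y u t v s. x = d \<and> y = d \<and> u = d \<and> t = d \<and> v = d) = d"
  "edge_count d (\<lambda>x y u t v s. x = d \<and> y = d \<and> u = d \<and> t = d \<and> s = d) = d"
  "edge_count d (\<lambda>x y u t v s. x = d \<and> y = d \<and> u = d \<and> v = d \<and> s = d) = d"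
proof -
  have "edge_count d (\<lambda>x y u t v s. x = d \<and> u = d \<and> t = d \<and> v = d \<and> s = d) = card {1..d}"
    by (rule edge_count_eq_card[where f = "\<lambda>(x, y, u, t, v, s). y" and g = "\<lambda>y. (d, y, d, d, d, d)"])
      (auto simp: metric_edges_def tri_def)
  then show "edge_count d (\<lambda>x y u t v s. x = d \<and> u = d \<and> t = d \<and> v = d \<and> s = d) = d"
    by simp
  have "edge_count d (\<lambda>x y u t v s. x = d \<and> y = d \<and> u = d \<and> t = d \<and> v = d) = card {1..d}"
    by (rule edge_count_eq_card[where f = "\<lambda>(x, y, u, t, v, s). s" and g = "\<lambda>s. (d, d, d, d, d, s)"])
      (auto simp: metric_edges_def tri_def)
  then show "edge_count d (\<lambda>x y u t v s. x = d \<and> y = d \<and> u = d \<and> t = d \<and> v = d) = d"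
    by simp
  have "edge_count d (\<lambda>x y u t v s. x = d \<and> y = d \<and> u = d \<and> t = d \<and> s = d) = card {1..d}"
    by (rule edge_count_eq_card[where f = "\<lambda>(x, y, u, t, v, s). v" and g = "\<lambda>v. (d, d, d, d, v, d)"])
      (auto simp: metric_edges_def tri_def)
  then show "edge_count d (\<lambda>x y u t v s. x = d \<and> y = d \<and> u = d \<and> t = d \<and> s = d) = d"
    by simp
  have "edge_count d (\<lambda>x y u t v s. x = d \<and> y = d \<and> u = d \<and> v = d \<and> s = d) = card {1..d}"
    by (rule edge_count_eq_card[where f = "\<lambda>(x, y, u, t, v, s). t" and g = "\<lambda>t. (d, d, d, t, d, d)"])
      (auto simp: metric_edges_def tri_def)
  then show "edge_count d (\<lambda>x y u t v s. x = d \<and> y = d \<and> u = d \<and> v = d \<and> s = d) = d"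
    by simp
qed

lemma edge_count_all:
  assumes "d > 0"
  shows "edge_count d (\<lambda>x y u t v s. x = d \<and> y = d \<and> u = d \<and> t = d \<and> v = d \<and> s = d) = 1"
proof -
  have "{(x, y, u, t, v, s). (x, y, u, t, v, s) \<in> metric_edges d \<and>
      x = d \<and> y = d \<and> u = d \<and> t = d \<and> v = d \<and> s = d} = {(d, d, d, d, d, d)}"
    using assms by (auto simp: metric_edges_def tri_def)
  then show ?thesis
    by (simp add: edge_count_def)
qed

text \<open>Inclusion and exclusion proceeds in two stages. First, each pair of opposite edges is
treated as one event, namely that one of the two edges has length $d$; the three events are
permuted by symmetry. Conjunctions of these events are then expanded one pair at a time.\<close>

lemma edge_count_pair:
  "edge_count d (\<lambda>x y u t v s. x = d \<or> y = d)
      + gap_sum d (\<lambda>m n. m ^ 2) = 2 * edge_count d (\<lambda>x y u t v s. x = d)"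
proof -
  have split: "edge_count d (\<lambda>x y u t v s. x = d \<or> y = d) +
      edge_count d (\<lambda>x y u t v s. x = d \<and> y = d) =
      edge_count d (\<lambda>x y u t v s. x = d) +
      edge_count d (\<lambda>x y u t v s. y = d)"
    by (rule edge_count_or) blast+
  have swap: "edge_count d (\<lambda>x y u t v s. y = d) =
      edge_count d (\<lambda>x y u t v s. x = d)"
    by (rule edge_count_swap_opposite) blast
  show ?thesis
    using split swap edge_count_opposite[of d] by simp
qed

lemma edge_count_two_pairs:
  "edge_count d (\<lambda>x y u t v s. (x = d \<or> y = d) \<and> (u = d \<or> t = d)) + 4 * (\<Sum>t\<in>{1..d}. t ^ 2) =
     4 * gap_sum d (\<lambda>m n. m * min (2 * m - 1) n) + d ^ 2"
proof -
  have split_xy: "edge_count d (\<lambda>x y u t v s. (x = d \<or> y = d) \<and> (u = d \<or> t = d)) +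
      edge_count d (\<lambda>x y u t v s. x = d \<and> y = d \<and> (u = d \<or> t = d)) =
      edge_count d (\<lambda>x y u t v s. x = d \<and> (u = d \<or> t = d)) +
      edge_count d (\<lambda>x y u t v s. y = d \<and> (u = d \<or> t = d))"
    by (rule edge_count_or) blast+
  have swap_xy: "edge_count d (\<lambda>x y u t v s. y = d \<and> (u = d \<or> t = d)) =
      edge_count d (\<lambda>x y u t v s. x = d \<and> (u = d \<or> t = d))"
    by (rule edge_count_swap_opposite) blast
  have split_x: "edge_count d (\<lambda>x y u t v s. x = d \<and> (u = d \<or> t = d)) +
      edge_count d (\<lambda>x y u t v s. x = d \<and> u = d \<and> t = d) =
      edge_count d (\<lambda>x y u t v s. x = d \<and> u = d) +
      edge_count d (\<lambda>x y u t v s. x = d \<and> t = d)"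
    by (rule edge_count_or) blast+
  have swap_x: "edge_count d (\<lambda>x y u t v s. x = d \<and> t = d) =
      edge_count d (\<lambda>x y u t v s. x = d \<and> u = d)"
    by (rule edge_count_swap_crossing) blast
  have path: "edge_count d (\<lambda>x y u t v s. x = d \<and> u = d \<and> t = d) =
      edge_count d (\<lambda>x y u t v s. x = d \<and> y = d \<and> u = d)"
    by (rule edge_count_exchange) blast
  have split_both: "edge_count d (\<lambda>x y u t v s. x = d \<and> y = d \<and> (u = d \<or> t = d)) +
      edge_count d (\<lambda>x y u t v s. x = d \<and> y = d \<and> u = d \<and> t = d) =
      edge_count d (\<lambda>x y u t v s. x = d \<and> y = d \<and> u = d) +
      edge_count d (\<lambda>x y u t v s. x = d \<and> y = d \<and> t = d)"
    by (rule edge_count_or) blast+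
  have swap_both: "edge_count d (\<lambda>x y u t v s. x = d \<and> y = d \<and> t = d) =
      edge_count d (\<lambda>x y u t v s. x = d \<and> y = d \<and> u = d)"
    by (rule edge_count_swap_crossing) blast
  show ?thesis
    using split_xy swap_xy split_x swap_x path split_both swap_both
      edge_count_adjacent[of d] edge_count_path[of d] edge_count_cycle[of d] by linarith
qed

lemma edge_count_three_pairs:
  assumes "d > 0"
  shows "edge_count d (\<lambda>x y u t v s. (x = d \<or> y = d) \<and> (u = d \<or> t = d) \<and> (v = d \<or> s = d)) + 12 * \<Sum>{1..d}
      + 1 =
     4 * gap_sum d (\<lambda>m n. if 2 * m > n then m else 0) + 4 * gap_sum d (\<lambda>m n. min (2 * m - 1) n) + 6 * d"
proof -
  have split_xy: "edge_count d (\<lambda>x y u t v s. (x = d \<or> y = d) \<and> (u = d \<or> t = d) \<and> (v = d \<or> s = d)) +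
      edge_count d (\<lambda>x y u t v s. x = d \<and> y = d \<and> (u = d \<or> t = d) \<and> (v = d \<or> s = d)) =
      edge_count d (\<lambda>x y u t v s. x = d \<and> (u = d \<or> t = d) \<and> (v = d \<or> s = d)) +
      edge_count d (\<lambda>x y u t v s. y = d \<and> (u = d \<or> t = d) \<and> (v = d \<or> s = d))"
    by (rule edge_count_or) blast+
  have swap_xy: "edge_count d (\<lambda>x y u t v s. y = d \<and> (u = d \<or> t = d) \<and> (v = d \<or> s = d)) =
      edge_count d (\<lambda>x y u t v s. x = d \<and> (u = d \<or> t = d) \<and> (v = d \<or> s = d))"
    by (rule edge_count_swap_opposite) blast
  have split_x: "edge_count d (\<lambda>x y u t v s. x = d \<and> (u = d \<or> t = d) \<and> (v = d \<or> s = d)) +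
      edge_count d (\<lambda>x y u t v s. x = d \<and> u = d \<and> t = d \<and> (v = d \<or> s = d)) =
      edge_count d (\<lambda>x y u t v s. x = d \<and> u = d \<and> (v = d \<or> s = d)) +
      edge_count d (\<lambda>x y u t v s. x = d \<and> t = d \<and> (v = d \<or> s = d))"
    by (rule edge_count_or) blast+
  have swap_x: "edge_count d (\<lambda>x y u t v s. x = d \<and> t = d \<and> (v = d \<or> s = d)) =
      edge_count d (\<lambda>x y u t v s. x = d \<and> u = d \<and> (v = d \<or> s = d))"
    by (rule edge_count_swap_crossing) blast
  have split_xu: "edge_count d (\<lambda>x y u t v s. x = d \<and> u = d \<and> (v = d \<or> s = d)) +
      edge_count d (\<lambda>x y u t v s. x = d \<and> u = d \<and> v = d \<and> s = d) =
      edge_count d (\<lambda>x y u t v s. x = d \<and> u = d \<and> v = d) +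
      edge_count d (\<lambda>x y u t v s. x = d \<and> u = d \<and> s = d)"
    by (rule edge_count_or) blast+
  have split_xut: "edge_count d (\<lambda>x y u t v s. x = d \<and> u = d \<and> t = d \<and> (v = d \<or> s = d)) +
      edge_count d (\<lambda>x y u t v s. x = d \<and> u = d \<and> t = d \<and> v = d \<and> s = d) =
      edge_count d (\<lambda>x y u t v s. x = d \<and> u = d \<and> t = d \<and> v = d) +
      edge_count d (\<lambda>x y u t v s. x = d \<and> u = d \<and> t = d \<and> s = d)"
    by (rule edge_count_or) blast+
  have split_both: "edge_count d (\<lambda>x y u t v s. x = d \<and> y = d \<and> (u = d \<or> t = d) \<and> (v = d \<or> s = d)) +
      edge_count d (\<lambda>x y u t v s. x = d \<and> y = d \<and> u = d \<and> t = d \<and> (v = d \<or> s = d)) =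
      edge_count d (\<lambda>x y u t v s. x = d \<and> y = d \<and> u = d \<and> (v = d \<or> s = d)) +
      edge_count d (\<lambda>x y u t v s. x = d \<and> y = d \<and> t = d \<and> (v = d \<or> s = d))"
    by (rule edge_count_or) blast+
  have swap_both: "edge_count d (\<lambda>x y u t v s. x = d \<and> y = d \<and> t = d \<and> (v = d \<or> s = d)) =
      edge_count d (\<lambda>x y u t v s. x = d \<and> y = d \<and> u = d \<and> (v = d \<or> s = d))"
    by (rule edge_count_swap_crossing) blast
  have split_xyu: "edge_count d (\<lambda>x y u t v s. x = d \<and> y = d \<and> u = d \<and> (v = d \<or> s = d)) +
      edge_count d (\<lambda>x y u t v s. x = d \<and> y = d \<and> u = d \<and> v = d \<and> s = d) =
      edge_count d (\<lambda>x y u t v s. x = d \<and> y = d \<and> u = d \<and> v = d) +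
      edge_count d (\<lambda>x y u t v s. x = d \<and> y = d \<and> u = d \<and> s = d)"
    by (rule edge_count_or) blast+
  have split_xyut: "edge_count d (\<lambda>x y u t v s. x = d \<and> y = d \<and> u = d \<and> t = d \<and> (v = d \<or> s = d)) +
      edge_count d (\<lambda>x y u t v s. x = d \<and> y = d \<and> u = d \<and> t = d \<and> v = d \<and> s = d) =
      edge_count d (\<lambda>x y u t v s. x = d \<and> y = d \<and> u = d \<and> t = d \<and> v = d) +
      edge_count d (\<lambda>x y u t v s. x = d \<and> y = d \<and> u = d \<and> t = d \<and> s = d)"
    by (rule edge_count_or) blast+
  show ?thesis
    using split_xy swap_xy split_x swap_x split_xu split_xut split_both swap_both split_xyu split_xyut
      edge_count_triangle[of d] edge_count_star[of d] edge_count_paw[of d] edge_count_all_but_one[of d]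
      edge_count_all[OF assms] by linarith
qed

text \<open>Inclusion and exclusion for the three pairs of opposite edges, where the three single events
and the three conjunctions of two events have equal counts by symmetry.\<close>

lemma edge_count_some:
  "edge_count d (\<lambda>x y u t v s. (x = d \<or> y = d) \<or> (u = d \<or> t = d) \<or> (v = d \<or> s = d)) +
     3 * edge_count d (\<lambda>x y u t v s. (x = d \<or> y = d) \<and> (u = d \<or> t = d)) =
     3 * edge_count d (\<lambda>x y u t v s. x = d \<or> y = d) +
      edge_count d (\<lambda>x y u t v s. (x = d \<or> y = d) \<and> (u = d \<or> t = d) \<and> (v = d \<or> s = d))"
proof -
  have split: "edge_count d (\<lambda>x y u t v s. (x = d \<or> y = d) \<or> (u = d \<or> t = d) \<or> (v = d \<or> s = d)) +
      edge_count d (\<lambda>x y u t v s. (x = d \<or> y = d) \<and> ((u = d \<or> t = d) \<or> (v = d \<or> s = d))) =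
      edge_count d (\<lambda>x y u t v s. x = d \<or> y = d) +
      edge_count d (\<lambda>x y u t v s. (u = d \<or> t = d) \<or> (v = d \<or> s = d))"
    by (rule edge_count_or) blast+
  have split_uv: "edge_count d (\<lambda>x y u t v s. (u = d \<or> t = d) \<or> (v = d \<or> s = d)) +
      edge_count d (\<lambda>x y u t v s. (u = d \<or> t = d) \<and> (v = d \<or> s = d)) =
      edge_count d (\<lambda>x y u t v s. u = d \<or> t = d) +
      edge_count d (\<lambda>x y u t v s. v = d \<or> s = d)"
    by (rule edge_count_or) blast+
  have split_x: "edge_count d (\<lambda>x y u t v s. (x = d \<or> y = d) \<and> ((u = d \<or> t = d) \<or> (v = d \<or> s = d))) +
      edge_count d (\<lambda>x y u t v s. (x = d \<or> y = d) \<and> (u = d \<or> t = d) \<and> (v = d \<or> s = d)) =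
      edge_count d (\<lambda>x y u t v s. (x = d \<or> y = d) \<and> (u = d \<or> t = d)) +
      edge_count d (\<lambda>x y u t v s. (x = d \<or> y = d) \<and> (v = d \<or> s = d))"
    by (rule edge_count_or) blast+
  have pair_u: "edge_count d (\<lambda>x y u t v s. u = d \<or> t = d) =
      edge_count d (\<lambda>x y u t v s. x = d \<or> y = d)"
    by (rule edge_count_exchange) blast
  have pair_v: "edge_count d (\<lambda>x y u t v s. v = d \<or> s = d) =
      edge_count d (\<lambda>x y u t v s. u = d \<or> t = d)"
    by (rule edge_count_rotate) blast
  have pairs_uv: "edge_count d (\<lambda>x y u t v s. (u = d \<or> t = d) \<and> (v = d \<or> s = d)) =
      edge_count d (\<lambda>x y u t v s. (x = d \<or> y = d) \<and> (u = d \<or> t = d))"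
    by (rule edge_count_rotate) blast
  have pairs_xv: "edge_count d (\<lambda>x y u t v s. (x = d \<or> y = d) \<and> (v = d \<or> s = d)) =
      edge_count d (\<lambda>x y u t v s. (u = d \<or> t = d) \<and> (v = d \<or> s = d))"
    by (rule edge_count_exchange) blast
  show ?thesis
    using split split_uv split_x pair_u pair_v pairs_uv pairs_xv by linarith
qed

lemma card_metric_edges_Suc:
  fixes d' :: nat
  defines "d \<equiv> Suc d'"
  shows "card (metric_edges d) = card (metric_edges d') +
      edge_count d (\<lambda>x y u t v s. (x = d \<or> y = d) \<or> (u = d \<or> t = d) \<or> (v = d \<or> s = d))"
proof -
  let ?top = "{(x, y, u, t, v, s). (x, y, u, t, v, s) \<in> metric_edges d \<and>
    ((x = d \<or> y = d) \<or> (u = d \<or> t = d) \<or> (v = d \<or> s = d))}"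
  have "metric_edges d = metric_edges d' \<union> ?top" "metric_edges d' \<inter> ?top = {}"
    by (auto simp: metric_edges_def d_def le_Suc_eq)
  then have "card (metric_edges d) = card (metric_edges d') + card ?top"
    using card_Un_disjoint[of "metric_edges d'" ?top] finite_metric_edges[of d'] by simp
  then show ?thesis
    by (simp only: edge_count_def)
qed

section \<open>Tuples with one edge of maximal length\<close>

text \<open>Measured from the corner, with $j = d + 1 - y - t$ and $i = d + 1 - v$, these pairs become
the triangle $1 \le i \le j \le s - y$.\<close>

lemma card_far_pairs:
  assumes "s \<le> (d::nat)" "y > 0"
  shows "card {(v, t). d - s < t \<and> t + y \<le> v \<and> v \<le> d} = \<Sum>{1..s - y}"
proof -
  have "bij_betw (\<lambda>(v, t). (d + 1 - y - t, d + 1 - v)) {(v, t). d - s < t \<and> t + y \<le> v \<and> v \<le> d}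
      (SIGMA j:{1..s - y}. {1..j})"
    by (rule bij_betw_byWitness[where f' = "\<lambda>(j, i). (d + 1 - i, d + 1 - y - j)"]) (use assms in auto)
  then have "card {(v, t). d - s < t \<and> t + y \<le> v \<and> v \<le> d} = card (SIGMA j:{1..s - y}. {1..j})"
    by (rule bij_betw_same_card)
  then show ?thesis
    by simp
qed

text \<open>The two corners removed from the rectangle are disjoint because $y > 0$. The hypothesis
$|u - s| < y$ ensures that they lie inside the rectangle, as $t + y \le v$ and $t > d - s$ give
$v > d - u$.\<close>

lemma card_near_pairs:
  assumes "u \<le> (d::nat)" "s \<le> d" "u < y + s" "s < y + u" "y > 0"
  shows "card {(v, t). d - u < v \<and> v \<le> d \<and> d - s < t \<and> t \<le> d \<and> v < y + t \<and> t < y + v}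
     + \<Sum>{1..u - y} + \<Sum>{1..s - y} = u * s"
proof -
  let ?near = "{(v, t). d - u < v \<and> v \<le> d \<and> d - s < t \<and> t \<le> d \<and> v < y + t \<and> t < y + v}"
  let ?above = "{(v, t). d - s < t \<and> t + y \<le> v \<and> v \<le> d}"
  let ?below = "{(v, t). d - u < v \<and> v + y \<le> t \<and> t \<le> d}"
  have fin: "finite ?near" "finite ?above" "finite ?below"
    by (rule finite_subset[of _ "{..d} \<times> {..d}"]; auto)+
  have "card ?below = card {(t, v). d - u < v \<and> v + y \<le> t \<and> t \<le> d}"
    by (rule bij_betw_same_card[OF bij_betw_byWitness[where f = prod.swap and f' = prod.swap]]) auto
  then have below: "card ?below = \<Sum>{1..u - y}"
    using card_far_pairs[of u d y] assms by simp
  have above: "card ?above = \<Sum>{1..s - y}"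
    using card_far_pairs[of s d y] assms by simp
  have "{d - u<..d} \<times> {d - s<..d} = ?near \<union> (?above \<union> ?below)"
    using assms by auto
  then have "u * s = card (?near \<union> (?above \<union> ?below))"
    using assms card_cartesian_product[of "{d - u<..d}" "{d - s<..d}"] by simp
  also have "\<dots> = card ?near + (card ?above + card ?below)"
    by (subst card_Un_disjoint, use fin in simp, use fin in simp, fastforce)
      (subst card_Un_disjoint, use fin assms in auto)
  finally show ?thesis
    using above below by simp
qed

lemma sum_Sigma_twice:
  assumes "finite A" "\<And>a. finite (B a)" "\<And>a b. finite (C a b)"
  shows "(\<Sum>a\<in>A. \<Sum>b\<in>B a. \<Sum>c\<in>C a b. f a b c) = (\<Sum>(a, b, c)\<in>(SIGMA a:A. SIGMA b:B a. C a b). f a b c)"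
proof -
  have "(\<Sum>a\<in>A. \<Sum>b\<in>B a. \<Sum>c\<in>C a b. f a b c) = (\<Sum>a\<in>A. \<Sum>(b, c)\<in>(SIGMA b:B a. C a b). f a b c)"
    using assms by (intro sum.cong refl sum.Sigma) auto
  also have "\<dots> = (\<Sum>(a, p)\<in>(SIGMA a:A. SIGMA b:B a. C a b). case p of (b, c) \<Rightarrow> f a b c)"
    using assms by (intro sum.Sigma) auto
  finally show ?thesis .
qed

text \<open>Only $y < u$ contributes. With $w = u - y$ the condition on $s$ becomes $w < s < w + 2y$,
and within $\{1, \dots, d\}$ this leaves \<open>min (2 y - 1) (d - w)\<close> values: the same expression as in
\<open>card_third_side\<close>.\<close>

lemma sum_gap_triangular:
  fixes d :: nat
  shows "(\<Sum>u\<in>{1..d}. \<Sum>s\<in>{1..d}. \<Sum>y\<in>{y \<in> {1..d}. u < y + s \<and> s < y + u}. \<Sum>{1..u - y}) =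
   (\<Sum>w\<in>{1..d}. \<Sum>{1..w} * (\<Sum>y\<in>{1..d - w}. min (2 * y - 1) (d - w)))"
proof -
  let ?all = "SIGMA u:{1..d}. SIGMA s:{1..d}. {y \<in> {1..d}. u < y + s \<and> s < y + u}"
  let ?pos = "SIGMA w:{1..d}. SIGMA y:{1..d - w}. {s \<in> {1..d}. w < s \<and> s < w + 2 * y}"
  have "(\<Sum>u\<in>{1..d}. \<Sum>s\<in>{1..d}. \<Sum>y\<in>{y \<in> {1..d}. u < y + s \<and> s < y + u}. \<Sum>{1..u - y}) =
      (\<Sum>(u, s, y)\<in>?all. \<Sum>{1..u - y})"
    by (rule sum_Sigma_twice) simp_all
  also have "\<dots> = (\<Sum>(u, s, y)\<in>{(u, s, y). (u, s, y) \<in> ?all \<and> y < u}. \<Sum>{1..u - y})"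
  proof (rule sum.mono_neutral_right)
    show "\<forall>e\<in>?all - {(u, s, y). (u, s, y) \<in> ?all \<and> y < u}. (case e of (u, s, y) \<Rightarrow> \<Sum>{1..u - y}) = 0"
    proof
      fix e assume e: "e \<in> ?all - {(u, s, y). (u, s, y) \<in> ?all \<and> y < u}"
      obtain u s y where "e = (u, s, y)"
        by (cases e)
      moreover from this e have "\<not> y < u"
        by auto
      ultimately show "(case e of (u, s, y) \<Rightarrow> \<Sum>{1..u - y}) = 0"
        by simp
    qed
  qed auto
  also have "\<dots> = (\<Sum>(w, y, s)\<in>?pos. \<Sum>{1..w})"
    by (rule sum.reindex_bij_witness[where j = "\<lambda>(u, s, y). (u - y, y, s)" and i = "\<lambda>(w, y, s). (w
        + y, s, y)"])
      auto
  also have "\<dots> = (\<Sum>w\<in>{1..d}. \<Sum>y\<in>{1..d - w}. \<Sum>s\<in>{s \<in> {1..d}. w < s \<and> s < w + 2 * y}. \<Sum>{1..w})"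
    by (rule sum_Sigma_twice[symmetric]) simp_all
  also have "\<dots> = (\<Sum>w\<in>{1..d}. \<Sum>y\<in>{1..d - w}. \<Sum>{1..w} * min (2 * y - 1) (d - w))"
  proof (intro sum.cong refl)
    fix w y assume "w \<in> {1..d}" "y \<in> {1..d - w}"
    then have "{s \<in> {1..d}. w < s \<and> s < w + 2 * y} = {w + 1..min d (w + 2 * y - 1)}"
      by auto
    moreover have "card {w + 1..min d (w + 2 * y - 1)} = min (2 * y - 1) (d - w)"
      by (auto simp: min_def)
    ultimately show "(\<Sum>s\<in>{s \<in> {1..d}. w < s \<and> s < w + 2 * y}. \<Sum>{1..w}) = \<Sum>{1..w} * min (2 * y - 1) (d - w)"
      by simp
  qed
  finally show ?thesis
    by (simp only: sum_distrib_left)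
qed

text \<open>These are the tuples with $x = d$ without the upper bounds on $y$. Summing \<open>card_near_pairs\<close>
over $u, s, y$ gives the main term $us\,(d - |u - s|)$, as there are $d - |u - s|$ values of $y$,
and two equal sums of triangular numbers.\<close>

lemma card_near_tuples:
  "card {(y, u, t, v, s). y \<in> {1..d} \<and> u \<in> {1..d} \<and> t \<in> {1..d} \<and> v \<in> {1..d} \<and> s \<in> {1..d} \<and>
       d < u + v \<and> d < s + t \<and> u < y + s \<and> s < y + u \<and> v < y + t \<and> t < y + v}
     + 2 * (\<Sum>w\<in>{1..d}. \<Sum>{1..w} * (\<Sum>y\<in>{1..d - w}. min (2 * y - 1) (d - w))) =
   gap_sum d (\<lambda>m n. m * (m + (d - n)) * n)" (is "card ?near + 2 * ?V = _")
proof -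
  let ?Y = "\<lambda>u s. {y \<in> {1..d}. u < y + s \<and> s < y + u}"
  let ?P = "\<lambda>u s y. {(v, t). d - u < v \<and> v \<le> d \<and> d - s < t \<and> t \<le> d \<and> v < y + t \<and> t < y + v}"
  have fin: "finite (?P u s y)" for u s y
    by (rule finite_subset[of _ "{..d} \<times> {..d}"]) auto
  have "bij_betw (\<lambda>(y, u, t, v, s). (u, s, y, v, t)) ?near
      (SIGMA u:{1..d}. SIGMA s:{1..d}. SIGMA y:?Y u s. ?P u s y)"
    by (rule bij_betw_byWitness[where f' = "\<lambda>(u, s, y, v, t). (y, u, t, v, s)"]) auto
  then have "card ?near = card (SIGMA u:{1..d}. SIGMA s:{1..d}. SIGMA y:?Y u s. ?P u s y)"
    by (rule bij_betw_same_card)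
  also have "\<dots> = (\<Sum>u\<in>{1..d}. \<Sum>s\<in>{1..d}. \<Sum>y\<in>?Y u s. card (?P u s y))"
    using fin by (simp add: card_SigmaI)
  finally have near: "card ?near = (\<Sum>u\<in>{1..d}. \<Sum>s\<in>{1..d}. \<Sum>y\<in>?Y u s. card (?P u s y))" .
  have swap: "(\<Sum>u\<in>{1..d}. \<Sum>s\<in>{1..d}. \<Sum>y\<in>?Y u s. \<Sum>{1..s - y}) =
      (\<Sum>u\<in>{1..d}. \<Sum>s\<in>{1..d}. \<Sum>y\<in>?Y u s. \<Sum>{1..u - y})"
    by (subst sum.swap) (intro sum.cong refl, auto)
  have "card ?near + (\<Sum>u\<in>{1..d}. \<Sum>s\<in>{1..d}. \<Sum>y\<in>?Y u s. \<Sum>{1..u - y})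
      + (\<Sum>u\<in>{1..d}. \<Sum>s\<in>{1..d}. \<Sum>y\<in>?Y u s. \<Sum>{1..s - y}) =
      (\<Sum>u\<in>{1..d}. \<Sum>s\<in>{1..d}. \<Sum>y\<in>?Y u s. card (?P u s y) + \<Sum>{1..u - y} + \<Sum>{1..s - y})"
    unfolding near by (simp only: sum.distrib)
  also have "\<dots> = (\<Sum>u\<in>{1..d}. \<Sum>s\<in>{1..d}. \<Sum>y\<in>?Y u s. u * s)"
  proof (intro sum.cong refl)
    fix u s y assume "u \<in> {1..d}" "s \<in> {1..d}" "y \<in> ?Y u s"
    then show "card (?P u s y) + \<Sum>{1..u - y} + \<Sum>{1..s - y} = u * s"
      by (intro card_near_pairs) auto
  qed
  also have "\<dots> = gap_sum d (\<lambda>m n. m * (m + (d - n)) * n)"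
    unfolding gap_sum_def
  proof (intro sum.cong refl)
    fix u s assume us: "u \<in> {1..d}" "s \<in> {1..d}"
    then have "?Y u s = {max u s - min u s + 1..d}"
      by (auto simp: min_def max_def)
    then have card_Y: "card (?Y u s) = d - (max u s - min u s)"
      by simp
    have max: "min u s + (d - (d - (max u s - min u s))) = max u s"
      using us by auto
    have product: "min u s * max u s = u * s"
      by (simp add: min_def max_def)
    show "(\<Sum>y\<in>?Y u s. u * s) = min u s * (min u s + (d - (d - (max u s - min u s)))) * (d - (max u s
        - min u s))"
      unfolding max product sum_constant card_Y by simp
  qed
  finally show ?thesis
    unfolding swap sum_gap_triangular by simp
qed

text \<open>The remaining bounds on $y$ are implied: $u + s \le y$ gives $|u - s| < y$, and $v > d - u$,
$t > d - s$ give $|v - t| < \max(u, s) < y$.\<close>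

lemma card_flat_tuples:
  "card {(y, u, t, v, s). y \<in> {1..d} \<and> u \<in> {1..d} \<and> t \<in> {1..d} \<and> v \<in> {1..d} \<and> s \<in> {1..d} \<and>
       d < u + v \<and> d < s + t \<and> u < y + s \<and> s < y + u \<and> v < y + t \<and> t < y + v \<and> u + s \<le> y} =
   (\<Sum>y\<in>{1..d}. \<Sum>u\<in>{1..y}. u * \<Sum>{1..y - u})" (is "card ?flat = _")
proof -
  let ?S = "SIGMA y:{1..d}. SIGMA u:{1..y}. SIGMA s:{1..y - u}. {d + 1 - u..d} \<times> {d + 1 - s..d}"
  have "bij_betw (\<lambda>(y, u, t, v, s). (y, u, s, v, t)) ?flat ?S"
    by (rule bij_betw_byWitness[where f' = "\<lambda>(y, u, s, v, t). (y, u, t, v, s)"]) auto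
  then have "card ?flat = card ?S"
    by (rule bij_betw_same_card)
  also have "\<dots> = (\<Sum>y\<in>{1..d}. \<Sum>u\<in>{1..y}. \<Sum>s\<in>{1..y - u}. u * s)"
    by (auto simp: card_cartesian_product intro!: sum.cong)
  finally show ?thesis
    by (simp only: sum_distrib_left)
qed

lemma sum_flat:
  "real (\<Sum>y\<in>{1..d}. \<Sum>u\<in>{1..y}. u * \<Sum>{1..y - u}) =
     (real d ^ 5 + 5 * real d ^ 4 + 5 * real d ^ 3 - 5 * real d ^ 2 - 6 * real d) / 120"
proof -
  have inner: "(\<Sum>u\<in>{1..k}. real u * ((y - real u) * (y - real u + 1) / 2)) =
      (3 * real k ^ 4 - 8 * real k ^ 3 * y + 2 * real k ^ 3 + 6 * real k ^ 2 * y ^ 2 - 6 * real k ^ 2 * y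
       - 3 * real k ^ 2 + 6 * real k * y ^ 2 + 2 * real k * y - 2 * real k) / 24" for k and y :: real
    by (induction k) (simp_all add: eval_nat_numeral field_simps)
  have "real (\<Sum>u\<in>{1..y}. u * \<Sum>{1..y - u}) = (\<Sum>u\<in>{1..y}. real u * ((real y - real u) * (real y - real u
      + 1) / 2))" for y
    unfolding of_nat_sum[of _ "{1..y}"] of_nat_mult triangular by (intro sum.cong refl)
        (auto simp: of_nat_diff)
  then have "real (\<Sum>u\<in>{1..y}. u * \<Sum>{1..y - u}) = (real y ^ 4 + 2 * real y ^ 3 - real y ^ 2
      - 2 * real y) / 24" for y
    unfolding inner by (simp add: eval_nat_numeral field_simps)
  then have "real (\<Sum>y\<in>{1..d}. \<Sum>u\<in>{1..y}. u * \<Sum>{1..y - u}) =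
      (\<Sum>y\<in>{1..d}. (real y ^ 4 + 2 * real y ^ 3 - real y ^ 2 - 2 * real y) / 24)"
    unfolding of_nat_sum[of _ "{1..d}"] by (simp only:)
  also have "\<dots> = (real d ^ 5 + 5 * real d ^ 4 + 5 * real d ^ 3 - 5 * real d ^ 2 - 6 * real d) / 120"
    by (induction d) (simp_all add: eval_nat_numeral field_simps)
  finally show ?thesis .
qed

text \<open>A tuple obeying the lower bounds on $y$ is metric unless $u + s \le y$ or $v + t \le y$.
These exclude each other and correspond to one another by exchanging $u$ with $v$ and $s$ with
$t$.\<close>

lemma edge_count_single:
  "edge_count d (\<lambda>x y u t v s. x = d)
     + 2 * (\<Sum>w\<in>{1..d}. \<Sum>{1..w} * (\<Sum>y\<in>{1..d - w}. min (2 * y - 1) (d - w)))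
     + 2 * (\<Sum>y\<in>{1..d}. \<Sum>u\<in>{1..y}. u * \<Sum>{1..y - u}) =
   gap_sum d (\<lambda>m n. m * (m + (d - n)) * n)"
proof -
  let ?near = "{(y, u, t, v, s). y \<in> {1..d} \<and> u \<in> {1..d} \<and> t \<in> {1..d} \<and> v \<in> {1..d} \<and> s \<in> {1..d} \<and>
       d < u + v \<and> d < s + t \<and> u < y + s \<and> s < y + u \<and> v < y + t \<and> t < y + v}"
  let ?flat = "{(y, u, t, v, s). y \<in> {1..d} \<and> u \<in> {1..d} \<and> t \<in> {1..d} \<and> v \<in> {1..d} \<and> s \<in> {1..d} \<and>
       d < u + v \<and> d < s + t \<and> u < y + s \<and> s < y + u \<and> v < y + t \<and> t < y + v \<and> u + s \<le> y}"
  let ?flat' = "{(y, u, t, v, s). y \<in> {1..d} \<and> u \<in> {1..d} \<and> t \<in> {1..d} \<and> v \<in> {1..d} \<and> s \<in> {1..d} \<and>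
       d < u + v \<and> d < s + t \<and> u < y + s \<and> s < y + u \<and> v < y + t \<and> t < y + v \<and> v + t \<le> y}"
  let ?metric = "{(y, u, t, v, s). (d, y, u, t, v, s) \<in> metric_edges d}"
  define near where "near = (\<lambda>(y, u, t, v, s). y \<in> {1..d} \<and> u \<in> {1..d} \<and> t \<in> {1..d} \<and> v \<in> {1..d}
      \<and> s \<in> {1..d} \<and>
       d < u + v \<and> d < s + t \<and> u < y + s \<and> s < y + u \<and> v < y + t \<and> t < y + v)"
  have near: "?near = Collect near" "?flat = {(y, u, t, v, s). near (y, u, t, v, s) \<and> u + s \<le> y}"
    "?flat' = {(y, u, t, v, s). near (y, u, t, v, s) \<and> v + t \<le> y}"
    by (simp_all add: near_def)
  have metric: "?metric = {(y, u, t, v, s). near (y, u, t, v, s) \<and> y < u + s \<and> y < v + t}"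
    by (auto simp: metric_edges_def tri_def near_def)
  have not_both: "\<not> (u + s \<le> y \<and> v + t \<le> y)" if "near (y, u, t, v, s)" for y u t v s
    using that by (auto simp: near_def)
  have fin: "finite ?near"
    by (rule finite_subset[of _ "{1..d} \<times> {1..d} \<times> {1..d} \<times> {1..d} \<times> {1..d}"]) auto
  have union: "?near = ?metric \<union> (?flat \<union> ?flat')"
    unfolding metric near by (auto simp: not_less)
  have fins: "finite ?metric" "finite ?flat" "finite ?flat'"
    using fin unfolding union finite_Un by blast+
  have disjoint: "?metric \<inter> (?flat \<union> ?flat') = {}" "?flat \<inter> ?flat' = {}"
    unfolding metric near using not_both by (auto simp: not_less)
  have "card ?near = card ?metric + (card ?flat + card ?flat')"
    unfolding union using fins disjoint by (simp add: card_Un_disjoint)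
  moreover have "card ?flat' = card ?flat"
    by (rule bij_betw_same_card[OF bij_betw_byWitness[where f = "\<lambda>(y, u, t, v, s). (y, v, s, u, t)"
            and f' = "\<lambda>(y, u, t, v, s). (y, v, s, u, t)"]]) auto
  moreover have "edge_count d (\<lambda>x y u t v s. x = d) = card ?metric"
    unfolding edge_count_def
    by (rule bij_betw_same_card[OF bij_betw_byWitness[where f = "\<lambda>(x, y, u, t, v, s). (y, u, t, v, s)"
            and f' = "\<lambda>(y, u, t, v, s). (d, y, u, t, v, s)"]]) auto
  ultimately show ?thesis
    using card_near_tuples[of d] card_flat_tuples[of d] by linarith
qed

lemma edge_count_single_closed:
  "real (edge_count d (\<lambda>x y u t v s. x = d)) =
     (68 * real d ^ 5 + 90 * real d ^ 4 + 60 * real d ^ 3 + 120 * real d ^ 2 + 112 * real d + 15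
         - 15 * (-1) ^ d) / 480"
  using edge_count_single[of d, THEN arg_cong[where f = real]]
  unfolding of_nat_add of_nat_mult[of 2] gap_sum_product sum_triangular_min sum_flat
  by (simp add: field_simps)

lemma edge_count_some_closed:
  assumes "d > 0"
  shows "real (edge_count d (\<lambda>x y u t v s. (x = d \<or> y = d) \<or> (u = d \<or> t = d) \<or> (v = d \<or> s = d))) =
     (68 * real d ^ 5 - 170 * real d ^ 4 + 300 * real d ^ 3 - 280 * real d ^ 2 + 232 * real d - 75
         - 5 * (-1) ^ d) / 80"
  using edge_count_some[of d, THEN arg_cong[where f = real]]
    edge_count_pair[of d, THEN arg_cong[where f = real]]
    edge_count_two_pairs[of d, THEN arg_cong[where f = real]]
    edge_count_three_pairs[OF assms, THEN arg_cong[where f = real]]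
    edge_count_single_closed[of d] gap_sum_squares[of d] gap_sum_times_min[of d] gap_sum_upper_half[of d]
    gap_sum_min[of d] sum_squares[of d] triangular[of d]
  by (simp add: field_simps power2_eq_square)

section \<open>The closed formulas\<close>

lemma card_metric_edges_closed:
  "real (card (metric_edges d)) =
     (68 * real d ^ 6 + 110 * real d ^ 4 + 272 * real d ^ 2 + 15 - 15 * (-1) ^ d) / 480"
proof (induction d)
  case 0
  have "metric_edges 0 = {}"
    by (auto simp: metric_edges_def)
  then show ?case by simp
next
  case (Suc d)
  then show ?case
    unfolding card_metric_edges_Suc of_nat_add edge_count_some_closed[OF zero_less_Suc]
    by (simp add: eval_nat_numeral field_simps)
qed

text \<open>The remaining counts belong to the permutations other than the identity. A transposition
makes $u = v$ and $s = t$, so the triangles over $x$ are isosceles and only ask for $x < 2u$ and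
$x < 2s$.\<close>

lemma card_isosceles:
  "card {(x, y, u, t, v, s). (x, y, u, t, v, s) \<in> metric_edges d \<and> u = v \<and> t = s} =
   gap_sum d (\<lambda>m n. min (2 * m - 1) d * min (2 * m - 1) n)"
proof -
  let ?S = "SIGMA u:{1..d}. SIGMA s:{1..d}. {x \<in> {1..d}. x < 2 * min u s} \<times> {y \<in> {1..d}. tri y u s}"
  have "bij_betw (\<lambda>(x, y, u, t, v, s). (u, s, x, y))
      {(x, y, u, t, v, s). (x, y, u, t, v, s) \<in> metric_edges d \<and> u = v \<and> t = s} ?S"
    by (rule bij_betw_byWitness[where f' = "\<lambda>(u, s, x, y). (x, y, u, s, u, s)"])
      (auto simp: metric_edges_def tri_def)
  then have "card {(x, y, u, t, v, s). (x, y, u, t, v, s) \<in> metric_edges d \<and> u = v \<and> t = s} = card ?S"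
    by (rule bij_betw_same_card)
  also have "\<dots> = (\<Sum>u\<in>{1..d}. \<Sum>s\<in>{1..d}. card ({x \<in> {1..d}. x < 2 * min u s} \<times> {y \<in> {1..d}. tri y u s}))"
    by (rule card_Sigma_square) simp
  also have "\<dots> = gap_sum d (\<lambda>m n. min (2 * m - 1) d * min (2 * m - 1) n)"
    unfolding gap_sum_def
  proof (intro sum.cong refl)
    fix u s assume us: "u \<in> {1..d}" "s \<in> {1..d}"
    have "{x \<in> {1..d}. x < 2 * min u s} = {1..min (2 * min u s - 1) d}"
      by auto
    then show "card ({x \<in> {1..d}. x < 2 * min u s} \<times> {y \<in> {1..d}. tri y u s}) =
        min (2 * min u s - 1) d * min (2 * min u s - 1) (d - (max u s - min u s))"
      by (simp only: card_cartesian_product card_third_side[OF us] card_atLeastAtMost) simp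
  qed
  finally show ?thesis .
qed

lemma card_opposite_equal:
  "card {(x, y, u, t, v, s). (x, y, u, t, v, s) \<in> metric_edges d \<and> u = t \<and> v = s} =
   gap_sum d (\<lambda>m n. min (2 * m - 1) n ^ 2)"
proof -
  let ?S = "SIGMA u:{1..d}. SIGMA s:{1..d}. {x \<in> {1..d}. tri x u s} \<times> {y \<in> {1..d}. tri y u s}"
  have "bij_betw (\<lambda>(x, y, u, t, v, s). (u, s, x, y))
      {(x, y, u, t, v, s). (x, y, u, t, v, s) \<in> metric_edges d \<and> u = t \<and> v = s} ?S"
    by (rule bij_betw_byWitness[where f' = "\<lambda>(u, s, x, y). (x, y, u, u, s, s)"])
      (auto simp: metric_edges_def tri_commute)
  then have "card {(x, y, u, t, v, s). (x, y, u, t, v, s) \<in> metric_edges d \<and> u = t \<and> v = s} = card ?S"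
    by (rule bij_betw_same_card)
  also have "\<dots> = (\<Sum>u\<in>{1..d}. \<Sum>s\<in>{1..d}. card ({x \<in> {1..d}. tri x u s} \<times> {y \<in> {1..d}. tri y u s}))"
    by (rule card_Sigma_square) simp
  also have "\<dots> = gap_sum d (\<lambda>m n. min (2 * m - 1) n ^ 2)"
    unfolding gap_sum_def
    by (intro sum.cong refl) (simp only: card_cartesian_product card_third_side power2_eq_square)
  finally show ?thesis .
qed

lemma card_short_base:
  "card (SIGMA b:{1..d}. {a \<in> {1..d}. a < 2 * b}) = (\<Sum>m\<in>{1..d}. min (2 * m - 1) d)"
proof -
  have "{a \<in> {1..d}. a < 2 * b} = {1..min (2 * b - 1) d}" for b
    by auto
  then show ?thesis
    by simp
qed

text \<open>Three-cycles and four-cycles leave two free edge lengths $a$ and $b$. In both cases the only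
nontrivial condition is $a < 2b$.\<close>

lemma card_equilateral_base:
  "card {(x, y, u, t, v, s). (x, y, u, t, v, s) \<in> metric_edges d \<and> x = u \<and> u = v \<and> y = t \<and> t = s} =
   (\<Sum>m\<in>{1..d}. min (2 * m - 1) d)"
  unfolding card_short_base[symmetric]
  by (rule bij_betw_same_card[OF bij_betw_byWitness[where f = "\<lambda>(x, y, u, t, v, s). (y, x)"
          and f' = "\<lambda>(b, a). (a, b, a, b, a, b)"]])
    (auto simp: metric_edges_def tri_def)

lemma card_equal_cycle:
  "card {(x, y, u, t, v, s). (x, y, u, t, v, s) \<in> metric_edges d \<and> x = v \<and> v = y \<and> y = s \<and> u = t} =
   (\<Sum>m\<in>{1..d}. min (2 * m - 1) d)"
  unfolding card_short_base[symmetric]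
  by (rule bij_betw_same_card[OF bij_betw_byWitness[where f = "\<lambda>(x, y, u, t, v, s). (x, u)"
          and f' = "\<lambda>(b, a). (b, b, a, a, b, b)"]])
    (auto simp: metric_edges_def tri_def)
text \<open>The terms of \<open>orbit_count\<close> with their multiplicities: identity, transpositions, double
transpositions, and the 8 three-cycles together with the 6 four-cycles, which fix equally many
matrices.\<close>

lemma alpha_hat_le_closed:
  "real (alpha_hat_le d) =
     (34 * real d ^ 6 + 850 * real d ^ 4 + 3391 * real d ^ 2 + 675 - (135 * real d ^ 2
         + 675) * (-1) ^ d) / 5760"
proof -
  have "24 * real (alpha_hat_le d) = real (card (metric_edges d))
      + 6 * real (gap_sum d (\<lambda>m n. min (2 * m - 1) d * min (2 * m - 1) n))
      + 3 * real (gap_sum d (\<lambda>m n. min (2 * m - 1) n ^ 2))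
      + 14 * real (\<Sum>m\<in>{1..d}. min (2 * m - 1) d)"
    using orbit_count[of d, THEN arg_cong[where f = real]]
    unfolding card_metric_matrices card_fixed_transposition card_fixed_double_transposition
      card_fixed_three_cycle card_fixed_four_cycle card_isosceles card_opposite_equal
      card_equilateral_base card_equal_cycle
    by simp
  then show ?thesis
    unfolding card_metric_edges_closed gap_sum_min_min gap_sum_min_squares sum_min
    by (simp add: field_simps)
qed

theorem theorem1:
  fixes d :: nat
  assumes "d > 0"
  shows "real (alpha_hat_le d) =
           (if even d
            then (17 * real d ^ 6 + 425 * real d ^ 4 + 1628 * real d ^ 2) / 2880
            else (17 * real d ^ 6 + 425 * real d ^ 4 + 1763 * real d ^ 2 + 675) / 2880)
       \<and> real (alpha_hat d) =
           (if even d
            then (34 * real d ^ 5 - 85 * real d ^ 4 + 680 * real d ^ 3 - 980 * real d ^ 2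
                  + 1776 * real d - 960) / 960
            else (34 * real d ^ 5 - 85 * real d ^ 4 + 680 * real d ^ 3 - 890 * real d ^ 2
                  + 1686 * real d - 465) / 960)"
proof
  show "real (alpha_hat_le d) =
           (if even d
            then (17 * real d ^ 6 + 425 * real d ^ 4 + 1628 * real d ^ 2) / 2880
            else (17 * real d ^ 6 + 425 * real d ^ 4 + 1763 * real d ^ 2 + 675) / 2880)"
    unfolding alpha_hat_le_closed by (simp add: field_simps)
  obtain k where d: "d = Suc k"
    using assms gr0_implies_Suc by blast
  have "real (alpha_hat d) = real (alpha_hat_le d) - real (alpha_hat_le k)"
    using alpha_hat_le_Suc[of k] by (simp add: d)
  moreover have "real k = real d - 1" "(-1 :: real) ^ k = - ((-1) ^ d)"
    by (simp_all add: d)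
  ultimately have difference: "real (alpha_hat d) =
      (34 * real d ^ 6 + 850 * real d ^ 4 + 3391 * real d ^ 2 + 675 - (135 * real d ^ 2
          + 675) * (-1) ^ d) / 5760
      - (34 * (real d - 1) ^ 6 + 850 * (real d - 1) ^ 4 + 3391 * (real d - 1) ^ 2 + 675
         + (135 * (real d - 1) ^ 2 + 675) * (-1) ^ d) / 5760"
    by (simp only: alpha_hat_le_closed) simp
  show "real (alpha_hat d) =
           (if even d
            then (34 * real d ^ 5 - 85 * real d ^ 4 + 680 * real d ^ 3 - 980 * real d ^ 2
                  + 1776 * real d - 960) / 960
            else (34 * real d ^ 5 - 85 * real d ^ 4 + 680 * real d ^ 3 - 890 * real d ^ 2
                  + 1686 * real d - 465) / 960)"
  proof (cases "even d")
    case True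
    then have "(-1 :: real) ^ d = 1"
      by simp
    then show ?thesis
      unfolding if_P[OF True] difference by (simp add: eval_nat_numeral field_simps)
  next
    case False
    then have "(-1 :: real) ^ d = -1"
      by simp
    then show ?thesis
      unfolding if_not_P[OF False] difference by (simp add: eval_nat_numeral field_simps)
  qed
qed

end
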